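(* Let $u_i'=f_i(t,u_1,\dots,u_n)$, $1\le i\le n$, be a regular system of ordinary differential equations, with each $f_i$ analytic in $t$ and polynomial in $u_1,\dots,u_n$. If the system passes the Painlevé test, i.e. admits a principal balance, then the Laurent series solutions obtained from the test (the formal Laurent series in $t-t_0$ constituting the principal balance) always converge.
   Context: Analytic means complex analytic. Balance. A balance of the system is a family of formal Laurent series solutions with movable singularity $t_0$, $$u_i=\sum_{j\ge 0}a_{i,j}\,(t-t_0)^{j-k_i},\qquad 1\le i\le n,$$ with integers $k_i$, depending on free parameters $t_0,r_2,\dots,r_{n_s}$ (the resonance parameters). There are integers $0\le\lambda_1<\dots<\lambda_s$ (the resonances) and $1=n_0<n_1<\dots<n_s$ such that: each $a_{i,j}$ is an analytic function of its variables; $a_{i,j}$ depends only on $t_0$ for $j<\lambda_1$; $a_{i,j}$ depends only on $t_0,r_2,\dots,r_{n_l}$ for $\lambda_l\le j<\lambda_{l+1}$; and $a_{i,j}$ depends only on $t_0,r_2,\dots,r_{n_s}$ for $j\ge\lambda_s$. Resonance matrix. Let $R_0=(-k_1a_{1,0},\dots,-k_na_{n,0})^T$ and, for $1\le l\le s$, let $R_l$ be the $n\times(n_l-n_{l-1})$ matrix with entries $\partial a_{i,\lambda_l}/\partial r_p$, $1\le i\le n$, $n_{l-1}<p\le n_l$. The resonance matrix is $R=(R_0\;R_1\;\cdots\;R_s)$, an $n\times n_s$ matrix. A balance is principal if $n_s=n$ and its resonance matrix is invertible. The system passes the Painlevé test if it admits a principal balance. Convergence of the Laurent series means convergence for $t\neq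 t_0$ in a neighborhood of $t_0$. *)

theory Defs
  imports
    "HOL-Complex_Analysis.Complex_Analysis"
    "Jordan_Normal_Form.Matrix"
begin

text \<open>
  Points of $\mathbb{C}^m$ and multi-indices are functions on \<open>{1..m}\<close>, extensional
  (\<open>undefined\<close>) elsewhere.  The components of a parameter point \<open>x\<close> are
  \<open>x 1\<close> $= t_0$ and \<open>x p\<close> $= r_p$ for \<open>p \<ge> 2\<close>.
\<close>

definition cspace :: "nat \<Rightarrow> (nat \<Rightarrow> complex) set" where
  "cspace m = ({1..m} \<rightarrow>\<^sub>E UNIV)"

definition multi_indices :: "nat \<Rightarrow> (nat \<Rightarrow> nat) set" where
  "multi_indices m = ({1..m} \<rightarrow>\<^sub>E UNIV)"

definition open_cspace :: "nat \<Rightarrow> (nat \<Rightarrow> complex) set \<Rightarrow> bool" where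
  "open_cspace m D \<longleftrightarrow> openin (product_topology (\<lambda>_. euclidean) {1..m}) D"

text \<open>Analyticity in several complex variables: local power series expansions on polydiscs.\<close>

definition mv_analytic_on :: "nat \<Rightarrow> ((nat \<Rightarrow> complex) \<Rightarrow> complex) \<Rightarrow> (nat \<Rightarrow> complex) set \<Rightarrow> bool" where
  "mv_analytic_on m g D \<longleftrightarrow>
     (\<forall>w\<in>D. \<exists>c :: (nat \<Rightarrow> nat) \<Rightarrow> complex. \<exists>\<rho>>0.
        \<forall>z\<in>cspace m. (\<forall>p\<in>{1..m}. dist (z p) (w p) < \<rho>) \<longrightarrow>
          ((\<lambda>\<alpha>. c \<alpha> * (\<Prod>p=1..m. (z p - w p) ^ \<alpha> p)) has_sum g z) (multi_indices m))"

definition depends_only_on :: "nat \<Rightarrow> ((nat \<Rightarrow> complex) \<Rightarrow> complex) \<Rightarrow> (nat \<Rightarrow> complex) set \<Rightarrow> bool" where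
  "depends_only_on m g D \<longleftrightarrow>
     (\<forall>x\<in>D. \<forall>y\<in>D. (\<forall>p\<in>{1..m}. x p = y p) \<longrightarrow> g x = g y)"

definition partial_deriv :: "nat \<Rightarrow> ((nat \<Rightarrow> complex) \<Rightarrow> complex) \<Rightarrow> (nat \<Rightarrow> complex) \<Rightarrow> complex" where
  "partial_deriv p g x = deriv (\<lambda>z. g (x(p := z))) (x p)"

text \<open>
  \<open>f i t u\<close> is $f_i(t,u_1,\dots,u_n)$, a polynomial in \<open>u\<close> whose coefficients \<open>c i \<alpha>\<close> are
  analytic in \<open>t \<in> \<Omega>\<close>; \<open>M\<close> contains the exponents occurring in any of the \<open>f i\<close>.
\<close>

definition polynomial_form ::
    "nat \<Rightarrow> complex set \<Rightarrow> (nat \<Rightarrow> complex \<Rightarrow> (nat \<Rightarrow> complex) \<Rightarrow> complex) \<Rightarrow>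
     (nat \<Rightarrow> nat) set \<Rightarrow> (nat \<Rightarrow> (nat \<Rightarrow> nat) \<Rightarrow> complex \<Rightarrow> complex) \<Rightarrow> bool" where
  "polynomial_form n \<Omega> f M c \<longleftrightarrow>
     finite M \<and> M \<subseteq> multi_indices n \<and>
     (\<forall>i\<in>{1..n}. \<forall>\<alpha>\<in>M. c i \<alpha> analytic_on \<Omega>) \<and>
     (\<forall>i\<in>{1..n}. \<forall>t\<in>\<Omega>. \<forall>u\<in>cspace n. f i t u = (\<Sum>\<alpha>\<in>M. c i \<alpha> t * (\<Prod>q=1..n. u q ^ \<alpha> q)))"

definition regular_system ::
    "nat \<Rightarrow> complex set \<Rightarrow> (nat \<Rightarrow> complex \<Rightarrow> (nat \<Rightarrow> complex) \<Rightarrow> complex) \<Rightarrow> bool" where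
  "regular_system n \<Omega> f \<longleftrightarrow> open \<Omega> \<and> (\<exists>M c. polynomial_form n \<Omega> f M c)"

text \<open>
  The data of a balance: $s$, the resonances $\lambda_1,\dots,\lambda_s$, the numbers
  $n_0,\dots,n_s$, the exponents $k_i$, the domain of the parameters $(t_0,r_2,\dots,r_{n_s})$, and
  the coefficient functions $a_{i,j}$.
\<close>

record balance_data =
  num_res :: nat
  resonance :: "nat \<Rightarrow> nat"
  num_par :: "nat \<Rightarrow> nat"
  expo :: "nat \<Rightarrow> int"
  par_dom :: "(nat \<Rightarrow> complex) set"
  coef :: "nat \<Rightarrow> nat \<Rightarrow> (nat \<Rightarrow> complex) \<Rightarrow> complex"

abbreviation total_par :: "balance_data \<Rightarrow> nat" where
  "total_par B \<equiv> num_par B (num_res B)"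

text \<open>The formal Laurent series $u_i$ in the variable $t - t_0$ at the parameter point \<open>x\<close>.\<close>

definition laurent_sol :: "balance_data \<Rightarrow> nat \<Rightarrow> (nat \<Rightarrow> complex) \<Rightarrow> complex fls" where
  "laurent_sol B i x = fls_shift (expo B i) (fps_to_fls (Abs_fps (\<lambda>j. coef B i j x)))"

text \<open>
  The coefficients of a polynomial form are expanded at $t_0$.  They are uniquely determined
  (up to zero terms) on \<open>\<Omega>\<close>, so the choice of the form is immaterial.
\<close>

definition formally_solves ::
    "nat \<Rightarrow> complex set \<Rightarrow> (nat \<Rightarrow> complex \<Rightarrow> (nat \<Rightarrow> complex) \<Rightarrow> complex) \<Rightarrow> balance_data \<Rightarrow> bool" where
  "formally_solves n \<Omega> f B \<longleftrightarrow>
     (\<exists>M c. polynomial_form n \<Omega> f M c \<and>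
        (\<forall>x\<in>par_dom B. \<forall>i\<in>{1..n}.
           fls_deriv (laurent_sol B i x) =
             (\<Sum>\<alpha>\<in>M. fps_to_fls (fps_expansion (c i \<alpha>) (x 1)) *
                       (\<Prod>q=1..n. laurent_sol B q x ^ \<alpha> q))))"

text \<open>
  In the last conjunct, \<open>l = 0\<close> covers the indices $j < \lambda_1$ and \<open>l = s\<close> the indices
  $j \ge \lambda_s$.  The case $s = 0$, where $t_0$ is the only parameter, is allowed.
\<close>

definition is_balance ::
    "nat \<Rightarrow> complex set \<Rightarrow> (nat \<Rightarrow> complex \<Rightarrow> (nat \<Rightarrow> complex) \<Rightarrow> complex) \<Rightarrow> balance_data \<Rightarrow> bool" where
  "is_balance n \<Omega> f B \<longleftrightarrow>
     strict_mono_on {1..num_res B} (resonance B) \<and>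
     num_par B 0 = 1 \<and> strict_mono_on {0..num_res B} (num_par B) \<and>
     open_cspace (total_par B) (par_dom B) \<and> par_dom B \<noteq> {} \<and>
     (\<forall>x\<in>par_dom B. x 1 \<in> \<Omega>) \<and>
     formally_solves n \<Omega> f B \<and>
     (\<forall>i\<in>{1..n}. \<forall>j. mv_analytic_on (total_par B) (coef B i j) (par_dom B)) \<and>
     (\<forall>l\<in>{0..num_res B}. \<forall>i\<in>{1..n}. \<forall>j.
        (1 \<le> l \<longrightarrow> resonance B l \<le> j) \<and> (l < num_res B \<longrightarrow> j < resonance B (Suc l)) \<longrightarrow>
        depends_only_on (num_par B l) (coef B i j) (par_dom B))"

definition res_block :: "balance_data \<Rightarrow> nat \<Rightarrow> nat" where
  "res_block B p = (THE l. l \<in> {1..num_res B} \<and> num_par B (l - 1) < p \<and> p \<le> num_par B l)"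

definition res_entry :: "balance_data \<Rightarrow> (nat \<Rightarrow> complex) \<Rightarrow> nat \<Rightarrow> nat \<Rightarrow> complex" where
  "res_entry B x i p =
     (if p = 1 then - of_int (expo B i) * coef B i 0 x
      else partial_deriv p (coef B i (resonance B (res_block B p))) x)"

text \<open>Matrix positions are counted from 0, equations and parameters from 1.\<close>

definition resonance_matrix :: "nat \<Rightarrow> balance_data \<Rightarrow> (nat \<Rightarrow> complex) \<Rightarrow> complex mat" where
  "resonance_matrix n B x = mat n (total_par B) (\<lambda>(i, p). res_entry B x (Suc i) (Suc p))"

definition principal_balance ::
    "nat \<Rightarrow> complex set \<Rightarrow> (nat \<Rightarrow> complex \<Rightarrow> (nat \<Rightarrow> complex) \<Rightarrow> complex) \<Rightarrow> balance_data \<Rightarrow> bool" where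
  "principal_balance n \<Omega> f B \<longleftrightarrow>
     is_balance n \<Omega> f B \<and> total_par B = n \<and>
     (\<forall>x\<in>par_dom B. invertible_mat (resonance_matrix n B x))"

definition passes_painleve_test ::
    "nat \<Rightarrow> complex set \<Rightarrow> (nat \<Rightarrow> complex \<Rightarrow> (nat \<Rightarrow> complex) \<Rightarrow> complex) \<Rightarrow> bool" where
  "passes_painleve_test n \<Omega> f \<longleftrightarrow> (\<exists>B. principal_balance n \<Omega> f B)"

definition balance_converges :: "nat \<Rightarrow> balance_data \<Rightarrow> bool" where
  "balance_converges n B \<longleftrightarrow>
     (\<forall>x\<in>par_dom B. \<exists>\<rho>>0. \<forall>t. 0 < dist t (x 1) \<and> dist t (x 1) < \<rho> \<longrightarrow>
        (\<forall>i\<in>{1..n}. summable (\<lambda>j. coef B i j x * (t - x 1) powi (int j - expo B i))))"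

end

theory Submission
  imports Defs
begin

text \<open>
  Write \<open>u\<^sub>i = \<tau>^(-k\<^sub>i) a\<^sub>i\<close> with \<open>\<tau> = t - t\<^sub>0\<close>.  Differentiating the formal solution in \<open>t\<^sub>0\<close> and the
  resonance parameters gives \<open>n\<close> formal solutions of the linearised system \<open>y' = A y\<close>, whose leading
  coefficients form the resonance matrix.  Its invertibility forces the entries
  \<open>\<tau>^(1 + k\<^sub>i - k\<^sub>q) A\<^sub>i\<^sub>q\<close> to be free of poles, although higher derivatives of the right-hand sides along the
  solution may have poles.  Splitting off a long enough initial segment of the \<open>a\<^sub>i\<close> kills those
  remaining poles, and the tail solves a system \<open>\<tau> w' + C w = c + \<tau> R(\<tau>, w)\<close> of Briot-Bouquet type,
  to which a majorant argument applies.
\<close>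

section \<open>Majorants\<close>

text \<open>Invertibility acts row by row: if a row of the rescaled matrix A had a pole, its lowest
  coefficients would form a nonzero left null vector of the resonance matrix. The t_0-column needs
  care, since moving t_0 changes both the coefficients and \<tau>: the total derivative is the
  coefficientwise one minus u'. Up to sign its leading term is -k_i a_{i,0} \<tau>^(-k_i-1), which
  explains that column and gives it the exponent -1 beside the resonances. The obstacle is that only
  the first derivative of the right-hand sides is controlled in this way. Single monomials may have
  strong poles that merely cancel along the solution, so Briot-Bouquet does not apply to the a_i
  themselves. The formal solution is given, so resonances in the recursion for the tail do no harm:
  finitely many coefficients count as constants, and the estimate starts where the factor j
  dominates the linear part. As no norm of the unknown series is known to be finite, the estimates
  concern partial sums, uniformly in their length.\<close>

definition fps_partial_norm :: "complex fps \<Rightarrow> real \<Rightarrow> nat \<Rightarrow> real" where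
  "fps_partial_norm f \<rho> J = (\<Sum>j\<le>J. norm (fps_nth f j) * \<rho> ^ j)"

lemma fps_partial_norm_nonneg: "0 \<le> \<rho> \<Longrightarrow> 0 \<le> fps_partial_norm f \<rho> J"
  by (simp add: fps_partial_norm_def sum_nonneg)

lemma fps_partial_norm_add:
  assumes "0 \<le> \<rho>"
  shows "fps_partial_norm (f + g) \<rho> J \<le> fps_partial_norm f \<rho> J + fps_partial_norm g \<rho> J"
  unfolding fps_partial_norm_def sum.distrib [symmetric]
  by (intro sum_mono) (auto simp: distrib_right [symmetric] assms intro!: mult_right_mono norm_triangle_ineq)

text \<open>The index pairs of the truncated Cauchy product form a triangle inside the square of
  pairs over which the product of the two truncated norms extends.\<close>

lemma fps_partial_norm_mult:
  assumes "0 \<le> \<rho>"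
  shows "fps_partial_norm (f * g) \<rho> J \<le> fps_partial_norm f \<rho> J * fps_partial_norm g \<rho> J"
proof -
  define a where "a = (\<lambda>(i, j). norm (fps_nth f i) * \<rho> ^ i * (norm (fps_nth g j) * \<rho> ^ j))"
  have "fps_partial_norm (f * g) \<rho> J \<le> (\<Sum>k\<le>J. \<Sum>i\<le>k. a (i, k - i))"
    unfolding fps_partial_norm_def
  proof (rule sum_mono)
    fix k
    have "norm (fps_nth (f * g) k) * \<rho> ^ k \<le> (\<Sum>i=0..k. norm (fps_nth f i * fps_nth g (k - i))) * \<rho> ^ k"
      unfolding fps_mult_nth by (intro mult_right_mono norm_sum) (simp add: assms)
    also have "\<dots> = (\<Sum>i\<le>k. a (i, k - i))"
      unfolding sum_distrib_right atLeast0AtMost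
      by (intro sum.cong) (auto simp: a_def norm_mult power_add [symmetric])
    finally show "norm (fps_nth (f * g) k) * \<rho> ^ k \<le> (\<Sum>i\<le>k. a (i, k - i))" .
  qed
  also have "\<dots> = (\<Sum>(i, j)\<in>{(i, j). i + j \<le> J}. a (i, j))"
    by (rule sum.triangle_reindex_eq [symmetric])
  also have "\<dots> \<le> (\<Sum>(i, j)\<in>{..J} \<times> {..J}. a (i, j))"
    by (intro sum_mono2) (auto simp: a_def assms)
  also have "\<dots> = fps_partial_norm f \<rho> J * fps_partial_norm g \<rho> J"
    unfolding fps_partial_norm_def sum_product
    by (simp add: sum.cartesian_product a_def)
  finally show ?thesis .
qed

lemma fps_conv_radius_pos_imp_partial_norm_bounded:
  assumes "fps_conv_radius f > 0"
  obtains M where "0 \<le> M" "\<forall>\<^sub>F \<rho> in at_right 0. \<forall>J. fps_partial_norm f \<rho> J \<le> M"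
proof -
  obtain r where r: "0 < ereal r" "ereal r < fps_conv_radius f"
    using assms by (rule ereal_dense2 [THEN exE]) auto
  hence r0: "r > 0" by simp
  have sm: "summable (\<lambda>j. norm (fps_nth f j) * r ^ j)"
    using abs_summable_in_conv_radius [of "of_real r" "fps_nth f"] r r0
    by (simp add: norm_mult norm_power fps_conv_radius_def)
  define M where "M = (\<Sum>j. norm (fps_nth f j) * r ^ j)"
  have "fps_partial_norm f \<rho> J \<le> M" if "0 < \<rho>" "\<rho> < r" for \<rho> J
  proof -
    have "fps_partial_norm f \<rho> J \<le> fps_partial_norm f r J"
      unfolding fps_partial_norm_def using that
      by (intro sum_mono mult_left_mono power_mono) auto
    also have "\<dots> \<le> M"
      unfolding fps_partial_norm_def M_def using r0 by (intro sum_le_suminf sm) auto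
    finally show ?thesis .
  qed
  moreover have "0 \<le> M" unfolding M_def using r0 by (intro suminf_nonneg sm) auto
  moreover have "\<forall>\<^sub>F \<rho> in at_right 0. 0 < \<rho> \<and> \<rho> < r"
    using r0 by (auto simp: eventually_at_right_field)
  ultimately show ?thesis
    by (intro that [of M]) (auto elim: eventually_mono)
qed

lemma fps_conv_radius_pos_if_partial_norm_bounded:
  assumes "0 < \<rho>" and "\<And>J. fps_partial_norm f \<rho> J \<le> M"
  shows "fps_conv_radius f > 0"
proof -
  have "summable (\<lambda>j. norm (fps_nth f j) * \<rho> ^ j)"
  proof (rule summableI_nonneg_bounded)
    fix J
    have "(\<Sum>j<J. norm (fps_nth f j) * \<rho> ^ j) \<le> fps_partial_norm f \<rho> J"
      unfolding fps_partial_norm_def using assms(1) by (intro sum_mono2) auto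
    also have "\<dots> \<le> M" by (rule assms(2))
    finally show "(\<Sum>j<J. norm (fps_nth f j) * \<rho> ^ j) \<le> M" .
  qed (use assms(1) in auto)
  hence "summable (\<lambda>j. fps_nth f j * of_real \<rho> ^ j)"
    using assms(1) by - (rule summable_norm_cancel, simp add: norm_mult norm_power)
  hence "conv_radius (fps_nth f) \<ge> norm (of_real \<rho> :: complex)"
    by (rule conv_radius_geI)
  thus ?thesis using assms(1) unfolding fps_conv_radius_def
    by (metis abs_of_pos ereal_less(2) norm_of_real order_less_le_trans)
qed

text \<open>\<open>S\<close> stands for the summed partial norms of the unknown series. The
  \<open>J\<close>-th partial norm is bounded through \<open>S\<close> at the same \<open>J\<close>,
  with \<open>M\<close> and \<open>d\<close> independent of \<rho> and \<open>J\<close>; this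
  permits an induction on \<open>J\<close> at one fixed \<rho>. The base is \<open>1 + S\<close>
  rather than \<open>S\<close> so that exponents can be raised.\<close>

definition fps_majorized :: "(real \<Rightarrow> nat \<Rightarrow> real) \<Rightarrow> complex fps set" where
  "fps_majorized S =
     {f. \<exists>M\<ge>0. \<exists>d. \<forall>\<^sub>F \<rho> in at_right 0. \<forall>J. fps_partial_norm f \<rho> J \<le> M * (1 + S \<rho> J) ^ d}"

section \<open>The majorized series form a ring containing the convergent series\<close>

locale majorant =
  fixes S :: "real \<Rightarrow> nat \<Rightarrow> real"
  assumes S_nonneg: "0 < \<rho> \<Longrightarrow> 0 \<le> S \<rho> J"
begin

lemma majorizedI:
  assumes "0 \<le> M" "\<forall>\<^sub>F \<rho> in at_right 0. \<forall>J. fps_partial_norm f \<rho> J \<le> M * (1 + S \<rho> J) ^ d"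
  shows "f \<in> fps_majorized S"
  using assms unfolding fps_majorized_def by blast

lemma eventually_pos: "\<forall>\<^sub>F \<rho> in at_right (0::real). 0 < \<rho>"
  by (rule eventually_at_right_less)

lemma majorized_add:
  assumes "f \<in> fps_majorized S" "g \<in> fps_majorized S"
  shows "f + g \<in> fps_majorized S"
proof -
  from assms obtain M d M' d' where M: "0 \<le> M" "0 \<le> M'" and
    ev: "\<forall>\<^sub>F \<rho> in at_right 0. \<forall>J. fps_partial_norm f \<rho> J \<le> M * (1 + S \<rho> J) ^ d"
        "\<forall>\<^sub>F \<rho> in at_right 0. \<forall>J. fps_partial_norm g \<rho> J \<le> M' * (1 + S \<rho> J) ^ d'"
    unfolding fps_majorized_def by blast
  have "\<forall>\<^sub>F \<rho> in at_right 0. \<forall>J. fps_partial_norm (f + g) \<rho> J \<le> (M + M') * (1 + S \<rho> J) ^ max d d'"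
    using ev eventually_pos
  proof eventually_elim
    case (elim \<rho>)
    show ?case
    proof
      fix J
      have "fps_partial_norm (f + g) \<rho> J \<le> M * (1 + S \<rho> J) ^ d + M' * (1 + S \<rho> J) ^ d'"
        using elim(1,2) [rule_format, of J] elim(3) fps_partial_norm_add [of \<rho> f g J] by linarith
      also have "\<dots> \<le> M * (1 + S \<rho> J) ^ max d d' + M' * (1 + S \<rho> J) ^ max d d'"
        using M S_nonneg [OF elim(3), of J]
        by (intro add_mono mult_left_mono power_increasing) auto
      finally show "fps_partial_norm (f + g) \<rho> J \<le> (M + M') * (1 + S \<rho> J) ^ max d d'"
        by (simp add: distrib_right)
    qed
  qed
  with M show ?thesis by (intro majorizedI) auto
qed

lemma majorized_mult:
  assumes "f \<in> fps_majorized S" "g \<in> fps_majorized S"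
  shows "f * g \<in> fps_majorized S"
proof -
  from assms obtain M d M' d' where M: "0 \<le> M" "0 \<le> M'" and
    ev: "\<forall>\<^sub>F \<rho> in at_right 0. \<forall>J. fps_partial_norm f \<rho> J \<le> M * (1 + S \<rho> J) ^ d"
        "\<forall>\<^sub>F \<rho> in at_right 0. \<forall>J. fps_partial_norm g \<rho> J \<le> M' * (1 + S \<rho> J) ^ d'"
    unfolding fps_majorized_def by blast
  have "\<forall>\<^sub>F \<rho> in at_right 0. \<forall>J. fps_partial_norm (f * g) \<rho> J \<le> (M * M') * (1 + S \<rho> J) ^ (d + d')"
    using ev eventually_pos
  proof eventually_elim
    case (elim \<rho>)
    show ?case
    proof
      fix J
      have "fps_partial_norm (f * g) \<rho> J \<le> fps_partial_norm f \<rho> J * fps_partial_norm g \<rho> J"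
        using elim by (intro fps_partial_norm_mult) auto
      also have "\<dots> \<le> (M * (1 + S \<rho> J) ^ d) * (M' * (1 + S \<rho> J) ^ d')"
        using elim M S_nonneg [OF elim(3), of J]
        by (intro mult_mono) (auto intro: fps_partial_norm_nonneg)
      finally show "fps_partial_norm (f * g) \<rho> J \<le> (M * M') * (1 + S \<rho> J) ^ (d + d')"
        by (simp add: power_add algebra_simps)
    qed
  qed
  with M show ?thesis by (intro majorizedI) auto
qed

lemma majorized_convergent: "fps_conv_radius f > 0 \<Longrightarrow> f \<in> fps_majorized S"
  by (erule fps_conv_radius_pos_imp_partial_norm_bounded)
    (rule majorizedI [where d = 0], auto)

lemma majorized_0: "0 \<in> fps_majorized S"
  and majorized_1: "1 \<in> fps_majorized S"
  by (auto intro!: majorized_convergent)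

lemma majorized_diff:
  assumes "f \<in> fps_majorized S" "g \<in> fps_majorized S"
  shows "f - g \<in> fps_majorized S"
proof -
  have "-1 \<in> fps_majorized S" by (intro majorized_convergent) simp
  from majorized_add [OF assms(1) majorized_mult [OF this assms(2)]] show ?thesis by simp
qed

lemma majorized_sum: "(\<And>i. i \<in> I \<Longrightarrow> f i \<in> fps_majorized S) \<Longrightarrow> sum f I \<in> fps_majorized S"
  by (induction I rule: infinite_finite_induct) (auto intro: majorized_add majorized_0)

lemma majorized_power: "f \<in> fps_majorized S \<Longrightarrow> f ^ n \<in> fps_majorized S"
  by (induction n) (auto intro: majorized_mult majorized_1)

lemma majorized_prod: "(\<And>i. i \<in> I \<Longrightarrow> f i \<in> fps_majorized S) \<Longrightarrow> prod f I \<in> fps_majorized S"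
  by (induction I rule: infinite_finite_induct) (auto intro: majorized_mult majorized_1)

end

text \<open>
  The recursion bounds the \<open>J\<close>-th partial norm \<open>S \<rho> J\<close> of the unknowns by a quantity that is
  small with \<open>\<rho>\<close> once the \<open>(J - 1)\<close>-st is bounded, so all of them stay bounded for a small \<open>\<rho>\<close>.
\<close>

lemma briot_bouquet_convergence:
  fixes w :: "'q \<Rightarrow> complex fps"
  assumes "finite Q"
  defines "S \<equiv> \<lambda>\<rho> J. \<Sum>q\<in>Q. fps_partial_norm (w q) \<rho> J"
  assumes R: "\<And>i. i \<in> Q \<Longrightarrow> R i \<in> fps_majorized S"
    and rec: "\<And>i j. i \<in> Q \<Longrightarrow> (of_nat (Suc j) + \<kappa> i) * fps_nth (w i) (Suc j)
                - (\<Sum>q\<in>Q. e i q * fps_nth (w q) (Suc j)) = fps_nth (R i) j"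
    and "q \<in> Q"
  shows "fps_conv_radius (w q) > 0"
proof -
  define W where "W = (\<lambda>j. \<Sum>i\<in>Q. norm (fps_nth (w i) j))"
  have W_nonneg: "0 \<le> W j" for j by (simp add: W_def sum_nonneg)
  have S_eq: "S \<rho> J = (\<Sum>j\<le>J. W j * \<rho> ^ j)" for \<rho> J
    unfolding S_def fps_partial_norm_def W_def sum_distrib_right by (rule sum.swap)
  interpret majorant S
    by unfold_locales (auto simp: S_def intro!: sum_nonneg fps_partial_norm_nonneg)

  obtain M d where M: "0 \<le> M" and
    ev: "\<forall>\<^sub>F \<rho> in at_right 0. \<forall>J. (\<Sum>i\<in>Q. fps_partial_norm (R i) \<rho> J) \<le> M * (1 + S \<rho> J) ^ d"
  proof -
    have "\<exists>M\<ge>0. \<exists>d. \<forall>\<^sub>F \<rho> in at_right 0. \<forall>J. (\<Sum>i\<in>Q. fps_partial_norm (R i) \<rho> J) \<le> M * (1 + S \<rho> J) ^ d"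
      using \<open>finite Q\<close> R
    proof (induction Q rule: finite_induct)
      case empty
      show ?case by (intro exI [of _ 0]) auto
    next
      case (insert i I)
      have "R i \<in> fps_majorized S" by (rule insert.prems) simp
      then obtain M' d' where M': "0 \<le> M'" and
        ev': "\<forall>\<^sub>F \<rho> in at_right 0. \<forall>J. fps_partial_norm (R i) \<rho> J \<le> M' * (1 + S \<rho> J) ^ d'"
        unfolding fps_majorized_def by blast
      have "\<exists>M\<ge>0. \<exists>d. \<forall>\<^sub>F \<rho> in at_right 0. \<forall>J. (\<Sum>i\<in>I. fps_partial_norm (R i) \<rho> J) \<le> M * (1 + S \<rho> J) ^ d"
        by (rule insert.IH) (rule insert.prems, simp)
      then obtain M d where M: "0 \<le> M" and
        ev: "\<forall>\<^sub>F \<rho> in at_right 0. \<forall>J. (\<Sum>i\<in>I. fps_partial_norm (R i) \<rho> J) \<le> M * (1 + S \<rho> J) ^ d"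
        by blast
      have "\<forall>\<^sub>F \<rho> in at_right 0. \<forall>J. (\<Sum>i\<in>insert i I. fps_partial_norm (R i) \<rho> J)
               \<le> (M + M') * (1 + S \<rho> J) ^ max d d'"
        using ev ev' eventually_pos
      proof eventually_elim
        case (elim \<rho>)
        show ?case
        proof
          fix J
          have "(\<Sum>i\<in>insert i I. fps_partial_norm (R i) \<rho> J)
                  \<le> M * (1 + S \<rho> J) ^ d + M' * (1 + S \<rho> J) ^ d'"
            using elim(1,2) [rule_format, of J] insert.hyps by simp
          also have "\<dots> \<le> M * (1 + S \<rho> J) ^ max d d' + M' * (1 + S \<rho> J) ^ max d d'"
            using M M' S_nonneg [OF elim(3), of J]
            by (intro add_mono mult_left_mono power_increasing) auto
          finally show "(\<Sum>i\<in>insert i I. fps_partial_norm (R i) \<rho> J)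
                          \<le> (M + M') * (1 + S \<rho> J) ^ max d d'"
            by (simp add: distrib_right)
        qed
      qed
      with M M' show ?case by (intro exI [of _ "M + M'"]) auto
    qed
    thus thesis using that by blast
  qed

  \<comment> \<open>\<open>C - 1\<close> bounds all linear terms except the factor
    \<open>Suc j\<close>. For \<open>Suc j \<ge> C\<close> they are absorbed, and at least one full
    \<open>W (Suc j)\<close> remains on the left.\<close>
  define C where "C = (\<Sum>i\<in>Q. norm (\<kappa> i)) + (\<Sum>i\<in>Q. \<Sum>q\<in>Q. norm (e i q)) + 1"
  have W_rec: "W (Suc j) \<le> (\<Sum>i\<in>Q. norm (fps_nth (R i) j))" if "C \<le> real (Suc j)" for j
  proof -
    have *: "real (Suc j) * norm (fps_nth (w i) (Suc j))
        \<le> norm (fps_nth (R i) j) + norm (\<kappa> i) * norm (fps_nth (w i) (Suc j))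
            + (\<Sum>q\<in>Q. norm (e i q) * norm (fps_nth (w q) (Suc j)))" if "i \<in> Q" for i
    proof -
      have "of_nat (Suc j) * fps_nth (w i) (Suc j) =
          fps_nth (R i) j - \<kappa> i * fps_nth (w i) (Suc j) + (\<Sum>q\<in>Q. e i q * fps_nth (w q) (Suc j))"
        using rec [OF that, of j] by (simp add: algebra_simps)
      hence "norm (of_nat (Suc j) * fps_nth (w i) (Suc j)) \<le> norm (fps_nth (R i) j)
          + norm (\<kappa> i * fps_nth (w i) (Suc j)) + norm (\<Sum>q\<in>Q. e i q * fps_nth (w q) (Suc j))"
        by (simp only:) (intro norm_triangle_le add_right_mono norm_triangle_ineq4)
      moreover have "norm (\<Sum>q\<in>Q. e i q * fps_nth (w q) (Suc j))
          \<le> (\<Sum>q\<in>Q. norm (e i q) * norm (fps_nth (w q) (Suc j)))"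
        by (rule order.trans [OF norm_sum]) (simp add: norm_mult)
      ultimately show ?thesis
        unfolding norm_mult norm_of_nat by linarith
    qed
    have "real (Suc j) * W (Suc j) \<le> (\<Sum>i\<in>Q. norm (fps_nth (R i) j)
        + norm (\<kappa> i) * norm (fps_nth (w i) (Suc j))
            + (\<Sum>q\<in>Q. norm (e i q) * norm (fps_nth (w q) (Suc j))))"
      unfolding W_def sum_distrib_left by (intro sum_mono *)
    also have "\<dots> \<le> (\<Sum>i\<in>Q. norm (fps_nth (R i) j)
        + norm (\<kappa> i) * W (Suc j) + (\<Sum>q\<in>Q. norm (e i q) * W (Suc j)))"
      unfolding W_def using \<open>finite Q\<close>
      by (intro sum_mono add_mono mult_left_mono order_refl member_le_sum) auto
    also have "\<dots> = (\<Sum>i\<in>Q. norm (fps_nth (R i) j)) + (C - 1) * W (Suc j)"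
      by (simp add: C_def sum.distrib sum_distrib_right distrib_right)
    finally have "(real (Suc j) - C) * W (Suc j) + W (Suc j) \<le> (\<Sum>i\<in>Q. norm (fps_nth (R i) j))"
      by (simp add: algebra_simps)
    moreover have "0 \<le> (real (Suc j) - C) * W (Suc j)"
      using that W_nonneg by (intro mult_nonneg_nonneg) auto
    ultimately show ?thesis by linarith
  qed

  obtain j0 where j0: "C \<le> real j0" using real_arch_simple by blast
  \<comment> \<open>Coefficients of index up to \<open>j0\<close>, where the linear part may be
    singular, are taken as given. The sum omits \<open>j = 0\<close>, so it tends to 0 with
    \<rho>.\<close>
  define init where "init = (\<lambda>\<rho>. \<Sum>j=1..j0. W j * \<rho> ^ j)"
  \<comment> \<open>\<open>2 + W 0\<close> is \<open>1 + S\<close> with the target bound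
    \<open>S \<le> W 0 + 1\<close> inserted; the single factor \<rho> comes from the index shift
    between \<open>w\<close> and \<open>R\<close> in the recursion. A total below 1 closes the
    induction on \<open>J\<close>.\<close>
  have "((\<lambda>\<rho>. init \<rho> + \<rho> * (M * (2 + W 0) ^ d)) \<longlongrightarrow> init 0 + 0 * (M * (2 + W 0) ^ d)) (at_right 0)"
    unfolding init_def by (intro tendsto_intros)
  moreover have "init 0 = 0" by (simp add: init_def)
  ultimately have "\<forall>\<^sub>F \<rho> in at_right 0. init \<rho> + \<rho> * (M * (2 + W 0) ^ d) < 1"
    by (intro order_tendstoD(2)) auto
  hence "\<forall>\<^sub>F \<rho> in at_right 0. 0 < \<rho> \<and> init \<rho> + \<rho> * (M * (2 + W 0) ^ d) < 1
       \<and> (\<forall>J. (\<Sum>i\<in>Q. fps_partial_norm (R i) \<rho> J) \<le> M * (1 + S \<rho> J) ^ d)"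
    using ev eventually_pos by eventually_elim auto
  from eventually_happens' [OF trivial_limit_at_right_real this]
  obtain \<rho> where \<rho>: "0 < \<rho>" "init \<rho> + \<rho> * (M * (2 + W 0) ^ d) < 1"
      and Rb: "\<And>J. (\<Sum>i\<in>Q. fps_partial_norm (R i) \<rho> J) \<le> M * (1 + S \<rho> J) ^ d"
    by blast

  have S_bound: "S \<rho> J \<le> W 0 + 1" for J
  proof (induction J)
    case 0
    show ?case by (simp add: S_eq)
  next
    case (Suc J)
    have term_bound: "W (Suc j) * \<rho> ^ Suc j \<le> (if Suc j \<le> j0 then W (Suc j) * \<rho> ^ Suc j else 0)
        + \<rho> * ((\<Sum>i\<in>Q. norm (fps_nth (R i) j)) * \<rho> ^ j)" for j
    proof (cases "Suc j \<le> j0")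
      case True
      thus ?thesis using \<rho>(1) by (auto intro!: mult_nonneg_nonneg sum_nonneg)
    next
      case False
      hence "W (Suc j) \<le> (\<Sum>i\<in>Q. norm (fps_nth (R i) j))" using j0 by (intro W_rec) linarith
      hence "W (Suc j) * \<rho> ^ Suc j \<le> (\<Sum>i\<in>Q. norm (fps_nth (R i) j)) * \<rho> ^ Suc j"
        using \<rho>(1) by (intro mult_right_mono) auto
      thus ?thesis using False by (simp add: mult_ac)
    qed
    have "S \<rho> (Suc J) = W 0 + (\<Sum>j\<le>J. W (Suc j) * \<rho> ^ Suc j)"
      unfolding S_eq by (subst sum.atMost_Suc_shift) simp
    moreover have "(\<Sum>j\<le>J. W (Suc j) * \<rho> ^ Suc j)
        \<le> (\<Sum>j\<le>J. if Suc j \<le> j0 then W (Suc j) * \<rho> ^ Suc j else 0)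
           + \<rho> * (\<Sum>j\<le>J. (\<Sum>i\<in>Q. norm (fps_nth (R i) j)) * \<rho> ^ j)"
      unfolding sum_distrib_left [of \<rho>] sum.distrib [symmetric] by (intro sum_mono term_bound)
    moreover have "(\<Sum>j\<le>J. if Suc j \<le> j0 then W (Suc j) * \<rho> ^ Suc j else 0) \<le> init \<rho>"
    proof -
      have "(\<Sum>j\<le>J. if Suc j \<le> j0 then W (Suc j) * \<rho> ^ Suc j else 0)
          = (\<Sum>j\<in>{j. j \<le> J \<and> Suc j \<le> j0}. W (Suc j) * \<rho> ^ Suc j)"
        by (rule sum.mono_neutral_cong_right) auto
      also have "\<dots> = (\<Sum>j\<in>Suc ` {j. j \<le> J \<and> Suc j \<le> j0}. W j * \<rho> ^ j)"
        by (simp add: sum.reindex)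
      also have "\<dots> \<le> init \<rho>"
        unfolding init_def using \<rho>(1) W_nonneg by (intro sum_mono2) auto
      finally show ?thesis .
    qed
    moreover have "\<rho> * (\<Sum>j\<le>J. (\<Sum>i\<in>Q. norm (fps_nth (R i) j)) * \<rho> ^ j) \<le> \<rho> * (M * (2 + W 0) ^ d)"
    proof (intro mult_left_mono)
      have "(\<Sum>j\<le>J. (\<Sum>i\<in>Q. norm (fps_nth (R i) j)) * \<rho> ^ j) = (\<Sum>i\<in>Q. fps_partial_norm (R i) \<rho> J)"
        unfolding fps_partial_norm_def sum_distrib_right by (rule sum.swap)
      also have "\<dots> \<le> M * (1 + S \<rho> J) ^ d" by (rule Rb)
      also have "\<dots> \<le> M * (2 + W 0) ^ d"
        using Suc.IH S_nonneg [OF \<rho>(1), of J] M by (intro mult_left_mono power_mono) auto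
      finally show "(\<Sum>j\<le>J. (\<Sum>i\<in>Q. norm (fps_nth (R i) j)) * \<rho> ^ j) \<le> M * (2 + W 0) ^ d" .
    qed (use \<rho>(1) in simp)
    ultimately show ?case using \<rho>(2) by linarith
  qed
  have "fps_partial_norm (w q) \<rho> J \<le> W 0 + 1" for J
  proof -
    have "fps_partial_norm (w q) \<rho> J \<le> S \<rho> J"
      unfolding S_def using assms(1,5) \<rho>(1) by (intro member_le_sum fps_partial_norm_nonneg) auto
    thus ?thesis using S_bound [of J] by linarith
  qed
  with \<rho>(1) show ?thesis by (rule fps_conv_radius_pos_if_partial_norm_bounded)
qed

section \<open>Formal power series solutions\<close>

definition power_prod :: "'q set \<Rightarrow> ('q \<Rightarrow> 'b::comm_semiring_1) \<Rightarrow> ('q \<Rightarrow> nat) \<Rightarrow> 'b" where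
  "power_prod Q u \<alpha> = (\<Prod>q\<in>Q. u q ^ \<alpha> q)"

text \<open>The monomial differentiated in its \<open>q\<close>-th variable. For
  \<open>\<alpha> q = 0\<close> the truncated exponent \<open>\<alpha> q - 1\<close> is harmless
  because the numerical factor vanishes.\<close>

definition power_prod_partial :: "'q set \<Rightarrow> ('q \<Rightarrow> 'b::comm_semiring_1) \<Rightarrow> ('q \<Rightarrow> nat) \<Rightarrow> 'q \<Rightarrow> 'b" where
  "power_prod_partial Q u \<alpha> q = of_nat (\<alpha> q) * power_prod Q u (\<alpha>(q := \<alpha> q - 1))"

text \<open>\<open>P F F'\<close> reads: \<open>F'\<close> is a derivative of the family
  \<open>F\<close> at the base index \<open>b\<close>. As only the product rule enters, one
  induction serves three derivations: first-order expansion in a perturbation (index type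
  \<open>bool\<close>), differentiation in a parameter (\<open>complex\<close>) and formal
  differentiation (\<open>unit\<close>).\<close>

lemma leibniz_power_prod:
  fixes P :: "('i \<Rightarrow> 'b::comm_semiring_1) \<Rightarrow> 'b \<Rightarrow> bool"
  assumes one: "P (\<lambda>_. 1) 0"
    and mult: "\<And>f f' g g'. P f f' \<Longrightarrow> P g g' \<Longrightarrow> P (\<lambda>z. f z * g z) (f b * g' + f' * g b)"
    and "finite Q" and u: "\<And>q. q \<in> Q \<Longrightarrow> P (u q) (u' q)"
  shows "P (\<lambda>z. power_prod Q (\<lambda>q. u q z) \<alpha>)
           (\<Sum>q\<in>Q. power_prod_partial Q (\<lambda>q. u q b) \<alpha> q * u' q)"
proof -
  have power: "P (\<lambda>z. f z ^ n) (of_nat n * f b ^ (n - 1) * f')" if "P f f'" for f f' n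
  proof (induction n)
    case 0
    show ?case using one by simp
  next
    case (Suc n)
    have "P (\<lambda>z. f z * f z ^ n) (f b * (of_nat n * f b ^ (n - 1) * f') + f' * f b ^ n)"
      by (rule mult [OF that Suc.IH])
    also have "f b * (of_nat n * f b ^ (n - 1) * f') + f' * f b ^ n
        = of_nat (Suc n) * f b ^ (Suc n - 1) * f'"
      by (cases n) (simp_all add: algebra_simps)
    finally show ?case by simp
  qed
  show ?thesis
    using \<open>finite Q\<close> u
  proof (induction Q rule: finite_induct)
    case empty
    show ?case using one by (simp add: power_prod_def)
  next
    case (insert r Q)
    have split: "power_prod (insert r Q) v \<beta> = v r ^ \<beta> r * power_prod Q v \<beta>" for v :: "'a \<Rightarrow> 'b" and \<beta>
      using insert.hyps by (simp add: power_prod_def)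
    have upd: "power_prod Q v (\<beta>(r := x)) = power_prod Q v \<beta>" for v :: "'a \<Rightarrow> 'b" and \<beta> x
      using insert.hyps unfolding power_prod_def by (intro prod.cong) auto
    have partial: "power_prod_partial (insert r Q) v \<alpha> q = v r ^ \<alpha> r * power_prod_partial Q v \<alpha> q"
      if "q \<in> Q" for v :: "'a \<Rightarrow> 'b" and q
    proof -
      have "q \<noteq> r" using that insert.hyps by auto
      thus ?thesis by (simp add: power_prod_partial_def split mult_ac)
    qed
    have partial_r: "power_prod_partial (insert r Q) v \<alpha> r
        = of_nat (\<alpha> r) * v r ^ (\<alpha> r - 1) * power_prod Q v \<alpha>" for v :: "'a \<Rightarrow> 'b"
      by (simp add: power_prod_partial_def split upd mult_ac)
    let ?u0 = "\<lambda>q. u q b"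
    have "P (\<lambda>z. u r z ^ \<alpha> r * power_prod Q (\<lambda>q. u q z) \<alpha>)
      (u r b ^ \<alpha> r * (\<Sum>q\<in>Q. power_prod_partial Q ?u0 \<alpha> q * u' q)
        + (of_nat (\<alpha> r) * u r b ^ (\<alpha> r - 1) * u' r) * power_prod Q ?u0 \<alpha>)"
      using insert.prems by (intro mult power insert.IH) auto
    also have "u r b ^ \<alpha> r * (\<Sum>q\<in>Q. power_prod_partial Q ?u0 \<alpha> q * u' q)
        + (of_nat (\<alpha> r) * u r b ^ (\<alpha> r - 1) * u' r) * power_prod Q ?u0 \<alpha>
      = (\<Sum>q\<in>insert r Q. power_prod_partial (insert r Q) ?u0 \<alpha> q * u' q)"
    proof -
      have "u r b ^ \<alpha> r * (\<Sum>q\<in>Q. power_prod_partial Q ?u0 \<alpha> q * u' q)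
          = (\<Sum>q\<in>Q. power_prod_partial (insert r Q) ?u0 \<alpha> q * u' q)"
        unfolding sum_distrib_left by (intro sum.cong) (auto simp: partial mult_ac)
      thus ?thesis using insert.hyps by (simp add: partial_r add_ac mult_ac)
    qed
    finally show ?case by (simp add: split)
  qed
qed

context majorant
begin

lemma majorized_power_prod:
  "(\<And>q. q \<in> Q \<Longrightarrow> u q \<in> fps_majorized S) \<Longrightarrow> power_prod Q u \<alpha> \<in> fps_majorized S"
  unfolding power_prod_def by (intro majorized_prod majorized_power)

lemma majorized_power_prod_partial:
  assumes "\<And>q. q \<in> Q \<Longrightarrow> u q \<in> fps_majorized S"
  shows "power_prod_partial Q u \<alpha> q \<in> fps_majorized S"
  unfolding power_prod_partial_def
  by (intro majorized_mult majorized_power_prod assms majorized_convergent)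
    (simp_all flip: fps_of_nat)

text \<open>A family over two points, \<open>False\<close> for the base value and
  \<open>True\<close> for the perturbed one, turns expansion modulo \<open>Y\<^sup>2\<close> into a
  product rule. Majorization is part of the invariant, so that the remainder stays majorized
  although it involves the unknown \<open>w\<close>.\<close>

lemma power_prod_taylor:
  assumes "finite Q" and Y: "Y \<in> fps_majorized S"
    and p: "\<And>q. q \<in> Q \<Longrightarrow> p q \<in> fps_majorized S"
    and w: "\<And>q. q \<in> Q \<Longrightarrow> w q \<in> fps_majorized S"
  shows "\<exists>R\<in>fps_majorized S. power_prod Q (\<lambda>q. p q + Y * w q) \<alpha> =
           power_prod Q p \<alpha> + Y * (\<Sum>q\<in>Q. power_prod_partial Q p \<alpha> q * w q) + Y\<^sup>2 * R"
proof -
  define P where "P = (\<lambda>F F'. F True \<in> fps_majorized S \<and> F False \<in> fps_majorized S \<and>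
    F' \<in> fps_majorized S \<and> (\<exists>R\<in>fps_majorized S. F True = F False + Y * F' + Y\<^sup>2 * R))"
  have "P (\<lambda>z. power_prod Q (\<lambda>q. if z then p q + Y * w q else p q) \<alpha>)
          (\<Sum>q\<in>Q. power_prod_partial Q (\<lambda>q. if False then p q + Y * w q else p q) \<alpha> q * w q)"
  proof (rule leibniz_power_prod [where b = False])
    show "P (\<lambda>_. 1) 0"
      unfolding P_def by (auto intro!: majorized_0 majorized_1 bexI [of _ 0])
    show "P (\<lambda>z. f z * g z) (f False * g' + f' * g False)" if "P f f'" "P g g'" for f f' g g'
    proof -
      from that obtain R T where
        R: "R \<in> fps_majorized S" "f True = f False + Y * f' + Y\<^sup>2 * R" and
        T: "T \<in> fps_majorized S" "g True = g False + Y * g' + Y\<^sup>2 * T"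
        unfolding P_def by blast
      have "f True * g True = f False * g False + Y * (f False * g' + f' * g False)
          + Y\<^sup>2 * (f' * g' + R * g True + f False * T + Y * (f' * T))"
        unfolding R(2) T(2) by (simp add: algebra_simps power2_eq_square)
      moreover have "f' * g' + R * g True + f False * T + Y * (f' * T) \<in> fps_majorized S"
        using that R(1) T(1) Y unfolding P_def by (auto intro!: majorized_add majorized_mult)
      moreover have "f True \<in> fps_majorized S" "f False \<in> fps_majorized S" "f' \<in> fps_majorized S"
        "g True \<in> fps_majorized S" "g False \<in> fps_majorized S" "g' \<in> fps_majorized S"
        using that unfolding P_def by blast+
      ultimately show ?thesis
        unfolding P_def by (intro conjI bexI majorized_add majorized_mult)
    qed
    show "P (\<lambda>z. if z then p q + Y * w q else p q) (w q)" if "q \<in> Q" for q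
      unfolding P_def using p [OF that] w [OF that] Y
      by (auto intro!: majorized_add majorized_mult bexI [of _ 0] majorized_0)
  qed fact
  thus ?thesis unfolding P_def by simp
qed

text \<open>The Taylor expansion applied to the lowered monomial. It serves to transfer divisibility
  of the linear part by a power of \<open>fps_X\<close> from the solution to its truncation.\<close>

lemma power_prod_partial_cong:
  assumes "finite Q" and Y: "Y \<in> fps_majorized S"
    and p: "\<And>q. q \<in> Q \<Longrightarrow> p q \<in> fps_majorized S"
    and w: "\<And>q. q \<in> Q \<Longrightarrow> w q \<in> fps_majorized S"
  shows "\<exists>R\<in>fps_majorized S. power_prod_partial Q (\<lambda>q. p q + Y * w q) \<alpha> q =
           power_prod_partial Q p \<alpha> q + Y * R"
proof -
  let ?\<beta> = "\<alpha>(q := \<alpha> q - 1)"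
  obtain R where R: "R \<in> fps_majorized S" "power_prod Q (\<lambda>q. p q + Y * w q) ?\<beta> =
      power_prod Q p ?\<beta> + Y * (\<Sum>q\<in>Q. power_prod_partial Q p ?\<beta> q * w q) + Y\<^sup>2 * R"
    using power_prod_taylor [where p = p and w = w, OF assms] by blast
  let ?R = "of_nat (\<alpha> q) * ((\<Sum>q\<in>Q. power_prod_partial Q p ?\<beta> q * w q) + Y * R)"
  have "of_nat (\<alpha> q) \<in> fps_majorized S"
    by (intro majorized_convergent) (simp flip: fps_of_nat)
  hence "?R \<in> fps_majorized S"
    using R(1) Y p w
    by (intro majorized_mult majorized_add majorized_sum majorized_power_prod_partial) auto
  moreover have "power_prod_partial Q (\<lambda>q. p q + Y * w q) \<alpha> q = power_prod_partial Q p \<alpha> q + Y * ?R"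
    unfolding power_prod_partial_def R(2) by (simp add: algebra_simps power2_eq_square)
  ultimately show ?thesis by blast
qed

end

section \<open>Positivity of the radius of convergence under algebraic operations\<close>

lemma fps_conv_radius_pos_add:
  "fps_conv_radius f > 0 \<Longrightarrow> fps_conv_radius g > 0 \<Longrightarrow> fps_conv_radius (f + g) > 0"
  using fps_conv_radius_add [of f g] by (metis less_le_trans min_less_iff_conj)

lemma fps_conv_radius_pos_diff:
  "fps_conv_radius f > 0 \<Longrightarrow> fps_conv_radius g > 0 \<Longrightarrow> fps_conv_radius (f - g) > 0"
  using fps_conv_radius_diff [of f g] by (metis less_le_trans min_less_iff_conj)

lemma fps_conv_radius_pos_mult:
  "fps_conv_radius f > 0 \<Longrightarrow> fps_conv_radius g > 0 \<Longrightarrow> fps_conv_radius (f * g) > 0"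
  using fps_conv_radius_mult [of f g] by (metis less_le_trans min_less_iff_conj)

lemma fps_conv_radius_pos_sum:
  "(\<And>i. i \<in> I \<Longrightarrow> fps_conv_radius (f i) > 0) \<Longrightarrow> fps_conv_radius (sum f I) > 0"
  by (induction I rule: infinite_finite_induct) (auto intro: fps_conv_radius_pos_add)

lemma fps_conv_radius_pos_power_prod:
  assumes "\<And>q. q \<in> Q \<Longrightarrow> fps_conv_radius (u q) > 0"
  shows "fps_conv_radius (power_prod Q u \<alpha>) > 0"
proof -
  have pow: "fps_conv_radius (f ^ n) > 0" if "fps_conv_radius f > 0" for f :: "'b fps" and n
    using that by (induction n) (auto intro: fps_conv_radius_pos_mult)
  show ?thesis
    unfolding power_prod_def using assms
    by (induction Q rule: infinite_finite_induct) (auto intro!: fps_conv_radius_pos_mult pow)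
qed

lemma fps_decomp_shift_1: "f = fps_const (fps_nth f 0) + fps_X * fps_shift 1 (f :: 'a::comm_ring_1 fps)"
proof (rule fps_ext)
  fix n show "fps_nth f n = fps_nth (fps_const (fps_nth f 0) + fps_X * fps_shift 1 f) n"
    by (cases n) auto
qed

text \<open>The cofactor is a mere shift of the coefficients, which preserves the radius.\<close>

lemma fps_X_power_dvdE:
  fixes f :: "'a::{banach, real_normed_field} fps"
  assumes "fps_X ^ n dvd f"
  obtains g where "f = fps_X ^ n * g" "fps_conv_radius g = fps_conv_radius f"
proof -
  from assms obtain g where g: "f = fps_X ^ n * g" by (rule dvdE)
  hence "g = fps_shift n f" by (simp add: mult.commute)
  hence "fps_conv_radius g = fps_conv_radius f" by simp
  with g show ?thesis by (rule that)
qed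

text \<open>
  Peel off \<open>a = p + X\<^sup>N w\<close> with \<open>p\<close> the truncation of order \<open>N = P + 1\<close>.  The second-order Taylor
  remainder then carries the factor \<open>X\<^sup>2\<^sup>N\<close>, which beats the pole of order \<open>P\<close>, while the linear
  term is free of poles by assumption; hence \<open>w\<close> solves a system of Briot-Bouquet type.
\<close>

theorem formal_solution_converges:
  fixes a :: "'q \<Rightarrow> complex fps" and G :: "'q \<Rightarrow> ('q \<Rightarrow> nat) \<Rightarrow> complex fps"
  assumes "finite Q"
    and G: "\<And>i \<alpha>. i \<in> Q \<Longrightarrow> \<alpha> \<in> M \<Longrightarrow> fps_conv_radius (G i \<alpha>) > 0"
    and eq: "\<And>i. i \<in> Q \<Longrightarrow> fps_X ^ P * (fps_X * fps_deriv (a i) - fps_const (\<kappa> i) * a i)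
               = (\<Sum>\<alpha>\<in>M. G i \<alpha> * power_prod Q a \<alpha>)"
    and reg: "\<And>i q. i \<in> Q \<Longrightarrow> q \<in> Q \<Longrightarrow> fps_X ^ P dvd (\<Sum>\<alpha>\<in>M. G i \<alpha> * power_prod_partial Q a \<alpha> q)"
    and "q \<in> Q"
  shows "fps_conv_radius (a q) > 0"
proof -
  \<comment> \<open>\<open>P\<close> alone would not do: since \<open>2 * N = P + N + 1\<close>,
    dividing \<open>Y\<^sup>2 * R\<close> by \<open>fps_X ^ (P + N)\<close> leaves one factor
    \<open>fps_X\<close>, which becomes the index shift from \<open>Suc j\<close> to
    \<open>j\<close> in the recursion.\<close>
  define N where "N = Suc P"
  define p where "p = (\<lambda>q. fps_cutoff N (a q))"
  define w where "w = (\<lambda>q. fps_shift N (a q))"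
  define Y :: "complex fps" where "Y = fps_X ^ N"
  have a_eq: "a = (\<lambda>q. p q + Y * w q)"
  proof
    fix q show "a q = p q + Y * w q"
      unfolding p_def w_def Y_def by (metis fps_shift_cutoff add.commute mult.commute)
  qed
  have p_conv: "fps_conv_radius (p q) > 0" for q
  proof -
    have "p q = fps_of_poly (poly_of_list (map (fps_nth (a q)) [0..<N]))"
      unfolding p_def by (rule fps_ext) (auto simp: nth_default_def)
    thus ?thesis by simp
  qed
  define S where "S = (\<lambda>\<rho> J. \<Sum>q\<in>Q. fps_partial_norm (w q) \<rho> J)"
  interpret majorant S
    by unfold_locales (auto simp: S_def intro!: sum_nonneg fps_partial_norm_nonneg)
  have pB: "p q \<in> fps_majorized S" for q
    by (intro majorized_convergent p_conv)
  have wB: "w q \<in> fps_majorized S" if "q \<in> Q" for q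
  proof (rule majorizedI [where M = 1 and d = 1])
    show "\<forall>\<^sub>F \<rho> in at_right 0. \<forall>J. fps_partial_norm (w q) \<rho> J \<le> 1 * (1 + S \<rho> J) ^ 1"
      using eventually_pos
    proof eventually_elim
      case (elim \<rho>)
      have "fps_partial_norm (w q) \<rho> J \<le> S \<rho> J" for J
        unfolding S_def using that elim \<open>finite Q\<close>
        by (intro member_le_sum fps_partial_norm_nonneg) auto
      thus ?case by (simp add: add_increasing)
    qed
  qed simp
  have YB: "Y \<in> fps_majorized S" by (intro majorized_convergent) (simp add: Y_def)
  have GB: "G i \<alpha> \<in> fps_majorized S" if "i \<in> Q" "\<alpha> \<in> M" for i \<alpha>
    by (intro majorized_convergent G that)

  have "\<exists>R\<in>fps_majorized S. \<exists>e. \<forall>j. (of_nat (Suc j) + (of_nat N - \<kappa> i)) * fps_nth (w i) (Suc j)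
                - (\<Sum>q\<in>Q. e q * fps_nth (w q) (Suc j)) = fps_nth R j" if i: "i \<in> Q" for i
  proof -
    \<comment> \<open>Regularity is assumed along \<open>a\<close>, but the expansion is about
      \<open>p\<close>. The two linear parts differ by a multiple of
      \<open>Y = fps_X * fps_X ^ P\<close>, so divisibility carries over; and as \<open>p\<close>
      and \<open>G\<close> converge, so does the quotient \<open>E\<close>.\<close>
    have "\<exists>E. (\<Sum>\<alpha>\<in>M. G i \<alpha> * power_prod_partial Q p \<alpha> q) = fps_X ^ P * E \<and> fps_conv_radius E > 0"
      if q: "q \<in> Q" for q
    proof -
      have "\<exists>R. power_prod_partial Q a \<alpha> q = power_prod_partial Q p \<alpha> q + Y * R" for \<alpha>
        using power_prod_partial_cong [where p = p and w = w, OF \<open>finite Q\<close> YB pB wB]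
        unfolding a_eq [symmetric] by blast
      then obtain R where R: "\<And>\<alpha>. power_prod_partial Q a \<alpha> q = power_prod_partial Q p \<alpha> q + Y * R \<alpha>"
        by metis
      have "(\<Sum>\<alpha>\<in>M. G i \<alpha> * power_prod_partial Q p \<alpha> q)
          = (\<Sum>\<alpha>\<in>M. G i \<alpha> * power_prod_partial Q a \<alpha> q) - fps_X ^ P * (fps_X * (\<Sum>\<alpha>\<in>M. G i \<alpha> * R \<alpha>))"
        unfolding R Y_def N_def by (simp add: algebra_simps sum.distrib sum_distrib_left)
      hence "fps_X ^ P dvd (\<Sum>\<alpha>\<in>M. G i \<alpha> * power_prod_partial Q p \<alpha> q)"
        using reg [OF i q] by simp
      moreover have "fps_conv_radius (\<Sum>\<alpha>\<in>M. G i \<alpha> * power_prod_partial Q p \<alpha> q) > 0"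
        unfolding power_prod_partial_def
        by (intro fps_conv_radius_pos_sum fps_conv_radius_pos_mult fps_conv_radius_pos_power_prod
              p_conv G i) (simp_all flip: fps_of_nat)
      ultimately show ?thesis by (metis fps_X_power_dvdE)
    qed
    then obtain E where
      E: "\<And>q. q \<in> Q \<Longrightarrow> (\<Sum>\<alpha>\<in>M. G i \<alpha> * power_prod_partial Q p \<alpha> q) = fps_X ^ P * E q"
         "\<And>q. q \<in> Q \<Longrightarrow> fps_conv_radius (E q) > 0" by metis
    have "\<exists>R\<in>fps_majorized S. power_prod Q a \<alpha> =
           power_prod Q p \<alpha> + Y * (\<Sum>q\<in>Q. power_prod_partial Q p \<alpha> q * w q) + Y\<^sup>2 * R" for \<alpha>
      using power_prod_taylor [where p = p and w = w, OF \<open>finite Q\<close> YB pB wB]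
      unfolding a_eq [symmetric] .
    then obtain R where
      R: "\<And>\<alpha>. R \<alpha> \<in> fps_majorized S"
         "\<And>\<alpha>. power_prod Q a \<alpha> =
           power_prod Q p \<alpha> + Y * (\<Sum>q\<in>Q. power_prod_partial Q p \<alpha> q * w q) + Y\<^sup>2 * R \<alpha>"
      by metis
    define R0 where "R0 = (\<Sum>\<alpha>\<in>M. G i \<alpha> * R \<alpha>)"
    \<comment> \<open>\<open>Z\<close> is the defect of the truncation \<open>p\<close> in the
      equation. It is built from convergent series only, and it is divisible by
      \<open>fps_X ^ (P + N)\<close> because \<open>a\<close> is an exact solution.\<close>
    define Z where "Z = fps_X ^ P * (fps_X * fps_deriv (p i) - fps_const (\<kappa> i) * p i)
                          - (\<Sum>\<alpha>\<in>M. G i \<alpha> * power_prod Q p \<alpha>)"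
    have lin: "(\<Sum>\<alpha>\<in>M. G i \<alpha> * (\<Sum>q\<in>Q. power_prod_partial Q p \<alpha> q * w q))
        = fps_X ^ P * (\<Sum>q\<in>Q. E q * w q)"
    proof -
      have "(\<Sum>\<alpha>\<in>M. G i \<alpha> * (\<Sum>q\<in>Q. power_prod_partial Q p \<alpha> q * w q))
          = (\<Sum>q\<in>Q. (\<Sum>\<alpha>\<in>M. G i \<alpha> * power_prod_partial Q p \<alpha> q) * w q)"
        unfolding sum_distrib_left sum_distrib_right by (subst sum.swap) (simp add: mult_ac)
      thus ?thesis by (simp add: E sum_distrib_left mult_ac)
    qed
    have rhs: "(\<Sum>\<alpha>\<in>M. G i \<alpha> * power_prod Q a \<alpha>) = (\<Sum>\<alpha>\<in>M. G i \<alpha> * power_prod Q p \<alpha>)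
        + Y * (fps_X ^ P * (\<Sum>q\<in>Q. E q * w q)) + Y\<^sup>2 * R0"
      unfolding R lin [symmetric] R0_def
      by (simp add: algebra_simps sum.distrib sum_distrib_left)
    \<comment> \<open>The Euler operator multiplies \<open>fps_X ^ N\<close> by \<open>N\<close>, so
      passing to the tail replaces \<open>\<kappa> i\<close> by
      \<open>\<kappa> i - N\<close>.\<close>
    have XdY: "fps_X * fps_deriv Y = of_nat N * Y"
      unfolding Y_def
    proof (induction N)
      case (Suc m)
      have "fps_X * fps_deriv (fps_X ^ Suc m :: complex fps)
          = fps_X ^ Suc m + fps_X * (fps_X * fps_deriv (fps_X ^ m))"
        by (simp add: algebra_simps del: fps_deriv_power)
      thus ?case unfolding Suc.IH by (simp add: algebra_simps)
    qed simp
    have lhs: "fps_X * fps_deriv (a i) - fps_const (\<kappa> i) * a i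
        = fps_X * fps_deriv (p i) - fps_const (\<kappa> i) * p i
           + Y * (fps_X * fps_deriv (w i) + (of_nat N - fps_const (\<kappa> i)) * w i)"
    proof -
      have "fps_X * fps_deriv (a i) = fps_X * fps_deriv (p i) + (fps_X * fps_deriv Y) * w i
              + Y * (fps_X * fps_deriv (w i))"
        unfolding a_eq by (simp add: algebra_simps)
      thus ?thesis unfolding XdY by (simp add: a_eq algebra_simps)
    qed
    let ?W = "fps_X * fps_deriv (w i) + (of_nat N - fps_const (\<kappa> i)) * w i"
    have "Z = fps_X ^ P * Y * ((\<Sum>q\<in>Q. E q * w q) + fps_X * R0 - ?W)"
    proof -
      have "Y\<^sup>2 * R0 = fps_X ^ P * Y * (fps_X * R0)"
        by (simp add: Y_def N_def power2_eq_square algebra_simps)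
      with eq [OF i] show ?thesis
        unfolding Z_def lhs rhs by (simp add: algebra_simps)
    qed
    hence Z: "Z = fps_X ^ (P + N) * ((\<Sum>q\<in>Q. E q * w q) + fps_X * R0 - ?W)"
      by (simp add: Y_def power_add)
    have Z_conv: "fps_conv_radius Z > 0"
      unfolding Z_def
      by (intro fps_conv_radius_pos_sum fps_conv_radius_pos_mult fps_conv_radius_pos_power_prod
            fps_conv_radius_pos_diff p_conv G i less_le_trans [OF _ fps_conv_radius_deriv]) simp_all
    from Z have "fps_X ^ (P + N) dvd Z" by simp
    then obtain Z' where Z': "Z = fps_X ^ (P + N) * Z'" "fps_conv_radius Z' = fps_conv_radius Z"
      by (rule fps_X_power_dvdE)
    have "(\<Sum>q\<in>Q. E q * w q) + fps_X * R0 - ?W = Z'"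
      using Z unfolding Z'(1) by (subst (asm) mult_cancel_left) simp
    hence W: "?W = (\<Sum>q\<in>Q. E q * w q) + fps_X * R0 - Z'"
      by (simp add: algebra_simps)
    have Z'_conv: "fps_conv_radius Z' > 0" using Z'(2) Z_conv by simp
    \<comment> \<open>The constant terms of \<open>E\<close> stay on the left as the matrix of the
      recursion. All else is \<open>fps_X * R'\<close>, up to the constant
      \<open>fps_nth Z' 0\<close>, which disappears when coefficients of index \<open>Suc j\<close>
      are compared.\<close>
    define R' where "R' = R0 + (\<Sum>q\<in>Q. fps_shift 1 (E q) * w q) - fps_shift 1 Z'"
    have "R' \<in> fps_majorized S"
      unfolding R'_def R0_def
      by (intro majorized_diff majorized_add majorized_sum majorized_mult R GB i wB)
        (auto intro!: majorized_convergent simp: E Z'_conv)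
    moreover have "(of_nat (Suc j) + (of_nat N - \<kappa> i)) * fps_nth (w i) (Suc j)
        - (\<Sum>q\<in>Q. fps_nth (E q) 0 * fps_nth (w q) (Suc j)) = fps_nth R' j" for j
    proof -
      have "?W - (\<Sum>q\<in>Q. fps_const (fps_nth (E q) 0) * w q) + fps_const (fps_nth Z' 0) = fps_X * R'"
      proof -
        have "(\<Sum>q\<in>Q. E q * w q) = (\<Sum>q\<in>Q. fps_const (fps_nth (E q) 0) * w q)
            + fps_X * (\<Sum>q\<in>Q. fps_shift 1 (E q) * w q)"
          unfolding sum_distrib_left sum.distrib [symmetric]
          by (intro sum.cong refl, subst fps_decomp_shift_1) (simp add: algebra_simps)
        moreover have "Z' = fps_const (fps_nth Z' 0) + fps_X * fps_shift 1 Z'"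
          by (rule fps_decomp_shift_1)
        ultimately show ?thesis unfolding W R'_def by (simp add: algebra_simps)
      qed
      hence "fps_nth (?W - (\<Sum>q\<in>Q. fps_const (fps_nth (E q) 0) * w q) + fps_const (fps_nth Z' 0)) (Suc j)
           = fps_nth (fps_X * R') (Suc j)" by simp
      thus ?thesis
        by (simp add: fps_sum_nth algebra_simps flip: fps_of_nat)
    qed
    ultimately show ?thesis
      by (intro bexI [of _ R'] exI [of _ "\<lambda>q. fps_nth (E q) 0"]) auto
  qed
  then obtain R e where
    R: "\<And>i. i \<in> Q \<Longrightarrow> R i \<in> fps_majorized S"
    and rec: "\<And>i j. i \<in> Q \<Longrightarrow> (of_nat (Suc j) + (of_nat N - \<kappa> i)) * fps_nth (w i) (Suc j)
                - (\<Sum>q\<in>Q. e i q * fps_nth (w q) (Suc j)) = fps_nth (R i) j"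
    by metis
  have "fps_conv_radius (w q) > 0"
    by (rule briot_bouquet_convergence [OF \<open>finite Q\<close> R [unfolded S_def] rec \<open>q \<in> Q\<close>])
  thus ?thesis
    by (simp add: w_def)
qed

section \<open>The linearised system\<close>

text \<open>
  Coefficientwise derivative at \<open>z0\<close> of a family of Laurent series; the common lower bound for the
  orders makes the coefficients of products finite sums of fixed length.
\<close>

definition fls_param_deriv :: "(complex \<Rightarrow> complex fls) \<Rightarrow> complex fls \<Rightarrow> complex \<Rightarrow> bool" where
  "fls_param_deriv U V z0 \<longleftrightarrow> (\<exists>N. \<forall>z. \<forall>k<N. fls_nth (U z) k = 0) \<and>
     (\<forall>k. ((\<lambda>z. fls_nth (U z) k) has_field_derivative fls_nth V k) (at z0))"

section \<open>Calculus of coefficientwise parameter derivatives\<close>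

lemma fls_times_nth_lower_bound:
  fixes f g :: "'a::comm_ring_1 fls"
  assumes "\<And>k. k < m \<Longrightarrow> fls_nth f k = 0" and "\<And>k. k < n \<Longrightarrow> fls_nth g k = 0"
  shows "fls_nth (f * g) k = (\<Sum>i=m..k - n. fls_nth f i * fls_nth g (k - i))"
proof (cases "f = 0 \<or> g = 0")
  case False
  hence "m \<le> fls_subdegree f" "n \<le> fls_subdegree g"
    using assms by (meson nth_fls_subdegree_nonzero not_le)+
  thus ?thesis
    unfolding fls_times_nth(2) by (intro sum.mono_neutral_left) auto
qed auto

lemma fls_param_deriv_const:
  assumes "\<And>z. U z = U z0"
  shows "fls_param_deriv U 0 z0"
  unfolding fls_param_deriv_def
proof
  have U: "U = (\<lambda>_. U z0)" using assms by blast
  show "\<exists>N. \<forall>z. \<forall>k<N. fls_nth (U z) k = 0"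
    by (subst U) (auto intro!: exI [of _ "fls_subdegree (U z0)"])
  show "\<forall>k. ((\<lambda>z. fls_nth (U z) k) has_field_derivative fls_nth 0 k) (at z0)"
    by (subst U) simp
qed

lemma fls_param_deriv_add:
  assumes "fls_param_deriv F F' z0" "fls_param_deriv G G' z0"
  shows "fls_param_deriv (\<lambda>z. F z + G z) (F' + G') z0"
proof -
  from assms obtain m n where "\<And>z k. k < m \<Longrightarrow> fls_nth (F z) k = 0" "\<And>z k. k < n \<Longrightarrow> fls_nth (G z) k = 0"
    unfolding fls_param_deriv_def by blast
  hence "\<forall>z. \<forall>k<min m n. fls_nth (F z + G z) k = 0" by simp
  thus ?thesis
    using assms unfolding fls_param_deriv_def by (auto intro!: DERIV_add exI [of _ "min m n"])
qed

lemma fls_param_deriv_sum: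
  assumes "finite M" "\<And>\<alpha>. \<alpha> \<in> M \<Longrightarrow> fls_param_deriv (F \<alpha>) (F' \<alpha>) z0"
  shows "fls_param_deriv (\<lambda>z. \<Sum>\<alpha>\<in>M. F \<alpha> z) (\<Sum>\<alpha>\<in>M. F' \<alpha>) z0"
  using assms
  by (induction M rule: finite_induct) (auto intro: fls_param_deriv_add fls_param_deriv_const)

lemma fls_param_deriv_mult:
  assumes "fls_param_deriv F F' z0" "fls_param_deriv G G' z0"
  shows "fls_param_deriv (\<lambda>z. F z * G z) (F z0 * G' + F' * G z0) z0"
proof -
  from assms obtain m n where
    m: "\<And>z k. k < m \<Longrightarrow> fls_nth (F z) k = 0" and n: "\<And>z k. k < n \<Longrightarrow> fls_nth (G z) k = 0"
    unfolding fls_param_deriv_def by blast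
  have F: "((\<lambda>z. fls_nth (F z) k) has_field_derivative fls_nth F' k) (at z0)"
    and G: "((\<lambda>z. fls_nth (G z) k) has_field_derivative fls_nth G' k) (at z0)" for k
    using assms unfolding fls_param_deriv_def by blast+
  \<comment> \<open>The derivatives vanish below the same bounds, so all three products can be
    summed over one common index range.\<close>
  have m': "fls_nth F' k = 0" if "k < m" for k
    using F [of k] m [OF that] by (auto intro: DERIV_unique)
  have n': "fls_nth G' k = 0" if "k < n" for k
    using G [of k] n [OF that] by (auto intro: DERIV_unique)
  have "((\<lambda>z. fls_nth (F z * G z) k) has_field_derivative fls_nth (F z0 * G' + F' * G z0) k) (at z0)" for k
  proof -
    have "((\<lambda>z. \<Sum>i=m..k - n. fls_nth (F z) i * fls_nth (G z) (k - i)) has_field_derivative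
        (\<Sum>i=m..k - n. fls_nth (F z0) i * fls_nth G' (k - i) + fls_nth F' i * fls_nth (G z0) (k - i))) (at z0)"
      by (intro DERIV_sum DERIV_mult' F G)
    thus ?thesis
      unfolding fls_plus_nth sum.distrib
      by (simp only: fls_times_nth_lower_bound [OF m n] fls_times_nth_lower_bound [OF m n']
            fls_times_nth_lower_bound [OF m' n])
  qed
  moreover have "fls_nth (F z * G z) k = 0" if "k < m + n" for z k
    using that by (subst fls_times_nth_lower_bound [OF m n]) auto
  ultimately show ?thesis
    unfolding fls_param_deriv_def by blast
qed

lemma fls_param_deriv_fls_deriv:
  assumes "fls_param_deriv U V z0"
  shows "fls_param_deriv (\<lambda>z. fls_deriv (U z)) (fls_deriv V) z0"
proof -
  from assms obtain N where "\<And>z k. k < N \<Longrightarrow> fls_nth (U z) k = 0"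
    unfolding fls_param_deriv_def by blast
  hence "\<forall>z. \<forall>k<N - 1. fls_nth (fls_deriv (U z)) k = 0" by simp
  thus ?thesis
    using assms unfolding fls_param_deriv_def by (auto intro!: DERIV_cmult)
qed

lemma fls_param_deriv_unique:
  assumes "fls_param_deriv F F' z0" "fls_param_deriv G G' z0" "\<forall>\<^sub>F z in nhds z0. F z = G z"
  shows "F' = G'"
proof (rule fls_eqI)
  fix k
  have "((\<lambda>z. fls_nth (F z) k) has_field_derivative fls_nth F' k) (at z0)"
    using assms unfolding fls_param_deriv_def by blast
  moreover have "\<forall>\<^sub>F z in nhds z0. fls_nth (F z) k = fls_nth (G z) k"
    using assms(3) by eventually_elim simp
  ultimately have "((\<lambda>z. fls_nth (G z) k) has_field_derivative fls_nth F' k) (at z0)"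
    by (simp add: DERIV_cong_ev)
  thus "fls_nth F' k = fls_nth G' k"
    using assms(2) unfolding fls_param_deriv_def by (blast intro: DERIV_unique)
qed

lemma fls_param_deriv_laurent:
  assumes "\<And>j. ((\<lambda>z. a z j) has_field_derivative b j) (at z0)"
  shows "fls_param_deriv (\<lambda>z. fls_shift m (fps_to_fls (Abs_fps (a z)))) (fls_shift m (fps_to_fls (Abs_fps b))) z0"
  unfolding fls_param_deriv_def
proof
  show "\<exists>N. \<forall>z. \<forall>k<N. fls_nth (fls_shift m (fps_to_fls (Abs_fps (a z)))) k = 0"
    by (intro exI [of _ "- m"]) auto
  show "\<forall>k. ((\<lambda>z. fls_nth (fls_shift m (fps_to_fls (Abs_fps (a z)))) k) has_field_derivative
          fls_nth (fls_shift m (fps_to_fls (Abs_fps b))) k) (at z0)"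
    using assms by simp
qed

text \<open>The \<open>j\<close>-th coefficient at centre \<open>z\<close> is
  \<open>c^(j)(z) / j!\<close>, whose derivative in \<open>z\<close> is \<open>j + 1\<close> times
  the next coefficient. Moving the centre therefore amounts to formal differentiation of the
  expansion.\<close>

lemma fls_param_deriv_fps_expansion:
  assumes "c analytic_on {z0}"
  shows "fls_param_deriv (\<lambda>z. fps_to_fls (fps_expansion c z)) (fls_deriv (fps_to_fls (fps_expansion c z0))) z0"
proof -
  from assms obtain r where r: "r > 0" "c holomorphic_on ball z0 r"
    unfolding analytic_on_def by blast
  have "((\<lambda>z. (deriv ^^ j) c z / fact j) has_field_derivative (deriv ^^ Suc j) c z0 / fact j) (at z0)" for j
  proof -
    have "(deriv ^^ j) c holomorphic_on ball z0 r"
      by (intro holomorphic_higher_deriv r) auto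
    hence "((deriv ^^ j) c has_field_derivative deriv ((deriv ^^ j) c) z0) (at z0)"
      using r(1) by (intro holomorphic_derivI [of _ "ball z0 r"]) auto
    thus ?thesis by (auto intro: DERIV_cdivide)
  qed
  hence "fls_param_deriv (\<lambda>z. fls_shift 0 (fps_to_fls (Abs_fps (\<lambda>j. (deriv ^^ j) c z / fact j))))
          (fls_shift 0 (fps_to_fls (Abs_fps (\<lambda>j. (deriv ^^ Suc j) c z0 / fact j)))) z0"
    by (rule fls_param_deriv_laurent)
  moreover have "Abs_fps (\<lambda>j. (deriv ^^ Suc j) c z0 / fact j) = fps_deriv (fps_expansion c z0)"
    unfolding fps_expansion_def by (rule fps_ext) (simp add: divide_simps del: of_nat_Suc)
  ultimately show ?thesis
    by (simp add: fps_expansion_def fls_deriv_fps_to_fls)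
qed

lemma fls_param_deriv_polynomial:
  assumes "finite Q" "finite M"
    and C: "\<And>\<alpha>. \<alpha> \<in> M \<Longrightarrow> fls_param_deriv (C \<alpha>) (C' \<alpha>) z0"
    and U: "\<And>q. q \<in> Q \<Longrightarrow> fls_param_deriv (U q) (V q) z0"
  shows "fls_param_deriv (\<lambda>z. \<Sum>\<alpha>\<in>M. C \<alpha> z * power_prod Q (\<lambda>q. U q z) \<alpha>)
    ((\<Sum>\<alpha>\<in>M. C' \<alpha> * power_prod Q (\<lambda>q. U q z0) \<alpha>)
     + (\<Sum>q\<in>Q. (\<Sum>\<alpha>\<in>M. C \<alpha> z0 * power_prod_partial Q (\<lambda>q. U q z0) \<alpha> q) * V q)) z0"
proof -
  have "fls_param_deriv (\<lambda>z. power_prod Q (\<lambda>q. U q z) \<alpha>)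
      (\<Sum>q\<in>Q. power_prod_partial Q (\<lambda>q. U q z0) \<alpha> q * V q) z0" for \<alpha>
    by (rule leibniz_power_prod [where P = "\<lambda>F F'. fls_param_deriv F F' z0"])
      (auto intro: fls_param_deriv_const fls_param_deriv_mult U \<open>finite Q\<close>)
  hence "fls_param_deriv (\<lambda>z. \<Sum>\<alpha>\<in>M. C \<alpha> z * power_prod Q (\<lambda>q. U q z) \<alpha>)
      (\<Sum>\<alpha>\<in>M. C \<alpha> z0 * (\<Sum>q\<in>Q. power_prod_partial Q (\<lambda>q. U q z0) \<alpha> q * V q)
        + C' \<alpha> * power_prod Q (\<lambda>q. U q z0) \<alpha>) z0"
    by (intro fls_param_deriv_sum fls_param_deriv_mult C \<open>finite M\<close>)
  moreover have "(\<Sum>\<alpha>\<in>M. C \<alpha> z0 * (\<Sum>q\<in>Q. power_prod_partial Q (\<lambda>q. U q z0) \<alpha> q * V q))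
      = (\<Sum>q\<in>Q. (\<Sum>\<alpha>\<in>M. C \<alpha> z0 * power_prod_partial Q (\<lambda>q. U q z0) \<alpha> q) * V q)"
    unfolding sum_distrib_left sum_distrib_right by (subst sum.swap) (simp add: mult_ac)
  ultimately show ?thesis by (simp add: sum.distrib add.commute)
qed

text \<open>The sum over \<open>fls_deriv (C \<alpha>)\<close> is also what
  \<open>fls_param_deriv_polynomial\<close> produces when the parameter is t_0, so these
  inhomogeneous terms cancel on subtraction.\<close>

lemma fls_deriv_polynomial:
  fixes u :: "'q \<Rightarrow> complex fls"
  assumes "finite Q"
  shows "fls_deriv (\<Sum>\<alpha>\<in>M. C \<alpha> * power_prod Q u \<alpha>) =
    (\<Sum>\<alpha>\<in>M. fls_deriv (C \<alpha>) * power_prod Q u \<alpha>)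
     + (\<Sum>q\<in>Q. (\<Sum>\<alpha>\<in>M. C \<alpha> * power_prod_partial Q u \<alpha> q) * fls_deriv (u q))"
proof -
  have sum: "fls_deriv (\<Sum>\<alpha>\<in>M. F \<alpha>) = (\<Sum>\<alpha>\<in>M. fls_deriv (F \<alpha>))" for F :: "('q \<Rightarrow> nat) \<Rightarrow> complex fls"
    by (induction M rule: infinite_finite_induct) auto
  have "fls_deriv (power_prod Q u \<alpha>) = (\<Sum>q\<in>Q. power_prod_partial Q u \<alpha> q * fls_deriv (u q))" for \<alpha>
    using leibniz_power_prod [where P = "\<lambda>F F'. fls_deriv (F ()) = F'" and u = "\<lambda>q _. u q" and b = "()"
        and u' = "\<lambda>q. fls_deriv (u q)" and Q = Q and \<alpha> = \<alpha>] assms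
    by simp
  hence "fls_deriv (\<Sum>\<alpha>\<in>M. C \<alpha> * power_prod Q u \<alpha>) =
      (\<Sum>\<alpha>\<in>M. C \<alpha> * (\<Sum>q\<in>Q. power_prod_partial Q u \<alpha> q * fls_deriv (u q))
        + fls_deriv (C \<alpha>) * power_prod Q u \<alpha>)"
    by (simp add: sum)
  moreover have "(\<Sum>\<alpha>\<in>M. C \<alpha> * (\<Sum>q\<in>Q. power_prod_partial Q u \<alpha> q * fls_deriv (u q)))
      = (\<Sum>q\<in>Q. (\<Sum>\<alpha>\<in>M. C \<alpha> * power_prod_partial Q u \<alpha> q) * fls_deriv (u q))"
    unfolding sum_distrib_left sum_distrib_right by (subst sum.swap) (simp add: mult_ac)
  ultimately show ?thesis by (simp add: sum.distrib add.commute)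
qed

text \<open>At a negative order below which all \<open>L q\<close> vanish, the sum sees only the
  constant terms of \<open>g\<close>. Regularity then makes the coefficients of the
  \<open>L q\<close> at this order a left null vector of the leading matrix, hence zero, and the
  next order can be treated.\<close>

lemma fls_regular_if_leading_matrix_nonsingular:
  fixes L :: "'q \<Rightarrow> complex fls" and g :: "'q \<Rightarrow> 'p \<Rightarrow> complex fps"
  assumes "finite Q"
    and reg: "\<And>p k. p \<in> I \<Longrightarrow> k < 0 \<Longrightarrow> fls_nth (\<Sum>q\<in>Q. L q * fps_to_fls (g q p)) k = 0"
    and nonsing: "\<And>c. (\<And>p. p \<in> I \<Longrightarrow> (\<Sum>q\<in>Q. c q * fps_nth (g q p) 0) = 0) \<Longrightarrow> (\<And>q. q \<in> Q \<Longrightarrow> c q = 0)"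
    and "q \<in> Q" "k < 0"
  shows "fls_nth (L q) k = 0"
proof -
  define N where "N = Min (insert 0 ((\<lambda>q. fls_subdegree (L q)) ` Q))"
  have N: "fls_nth (L q) k = 0" if "q \<in> Q" "k < N" for q k
  proof (rule fls_eq0_below_subdegree)
    have "N \<le> fls_subdegree (L q)"
      unfolding N_def using that \<open>finite Q\<close> by (intro Min_le) auto
    thus "k < fls_subdegree (L q)" using that by simp
  qed
  have "\<forall>q\<in>Q. fls_nth (L q) (N + int m) = 0" if "N + int m < 0" for m
    using that
  proof (induction m rule: less_induct)
    case (less m)
    have below: "fls_nth (L q) k = 0" if "q \<in> Q" "k < N + int m" for q k
    proof (cases "k < N")
      case False
      with that have "k = N + int (nat (k - N))" "nat (k - N) < m" by auto
      with less.IH [of "nat (k - N)"] less.prems that show ?thesis by auto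
    qed (use N that in auto)
    have "(\<Sum>q\<in>Q. fls_nth (L q) (N + int m) * fps_nth (g q p) 0) = 0" if "p \<in> I" for p
    proof -
      have "fls_nth (\<Sum>q\<in>Q. L q * fps_to_fls (g q p)) (N + int m)
          = (\<Sum>q\<in>Q. fls_nth (L q * fps_to_fls (g q p)) (N + int m))"
        by (simp add: fls_nth_sum)
      also have "\<dots> = (\<Sum>q\<in>Q. fls_nth (L q) (N + int m) * fps_nth (g q p) 0)"
      proof (rule sum.cong)
        fix q assume "q \<in> Q"
        thus "fls_nth (L q * fps_to_fls (g q p)) (N + int m) = fls_nth (L q) (N + int m) * fps_nth (g q p) 0"
          by (subst fls_times_nth_lower_bound [where m = "N + int m" and n = 0]) (auto intro: below)
      qed simp
      finally show ?thesis using reg [OF that less.prems] by simp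
    qed
    from nonsing [OF this] show ?case by blast
  qed
  from this [of "nat (k - N)"] show ?thesis
    using N assms by (cases "k < N") auto
qed

section \<open>Exponent bookkeeping between Laurent and power series\<close>

lemma fls_shift_sum: "fls_shift m (\<Sum>x\<in>A. f x) = (\<Sum>x\<in>A. fls_shift m (f x))"
  by (rule fls_eqI) (simp add: fls_nth_sum)

lemma fps_to_fls_sum: "fps_to_fls (\<Sum>x\<in>A. f x) = (\<Sum>x\<in>A. fps_to_fls (f x))"
  by (rule fls_eqI) (simp add: fls_nth_sum fps_sum_nth)

lemma fps_to_fls_X_power_mult:
  "fps_to_fls (fps_X ^ n * f) = fls_shift (- int n) (fps_to_fls (f :: 'a::comm_ring_1 fps))"
proof (rule fls_eqI)
  fix k
  show "fls_nth (fps_to_fls (fps_X ^ n * f)) k = fls_nth (fls_shift (- int n) (fps_to_fls f)) k"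
    by (auto simp: fps_X_power_mult_nth nat_diff_distrib)
qed

text \<open>\<open>fls_shift m\<close> is multiplication by \<open>X^(-m)\<close>, so the exponents
  add up to the weighted degree of \<open>\<alpha>\<close> with weights \<open>e\<close>.\<close>

lemma power_prod_laurent:
  fixes a :: "'q \<Rightarrow> complex fps" and e :: "'q \<Rightarrow> int"
  shows "power_prod Q (\<lambda>q. fls_shift (e q) (fps_to_fls (a q))) \<alpha>
           = fls_shift (\<Sum>q\<in>Q. int (\<alpha> q) * e q) (fps_to_fls (power_prod Q a \<alpha>))"
proof -
  have pow: "fls_shift m f ^ n = fls_shift (int n * m) (f ^ n)" for m n and f :: "complex fls"
    by (induction n) (auto simp: fls_times_both_shifted_simp algebra_simps)
  show ?thesis
    unfolding power_prod_def
    by (induction Q rule: infinite_finite_induct)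
      (auto simp: pow fls_times_both_shifted_simp fls_times_fps_to_fls fps_to_fls_power)
qed

lemma power_prod_partial_laurent:
  fixes a :: "'q \<Rightarrow> complex fps" and e :: "'q \<Rightarrow> int"
  assumes "finite Q" "q \<in> Q"
  shows "power_prod_partial Q (\<lambda>q. fls_shift (e q) (fps_to_fls (a q))) \<alpha> q
           = fls_shift ((\<Sum>q\<in>Q. int (\<alpha> q) * e q) - e q) (fps_to_fls (power_prod_partial Q a \<alpha> q))"
proof (cases "\<alpha> q = 0")
  case False
  have "(\<Sum>r\<in>Q. int ((\<alpha>(q := \<alpha> q - 1)) r) * e r) = int (\<alpha> q - 1) * e q + (\<Sum>r\<in>Q - {q}. int (\<alpha> r) * e r)"
    using assms by (subst sum.remove [of _ q]) auto
  also have "\<dots> = (\<Sum>r\<in>Q. int (\<alpha> r) * e r) - e q"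
    using assms False by (subst (2) sum.remove [of _ q]) (auto simp: algebra_simps of_nat_diff)
  finally show ?thesis
    unfolding power_prod_partial_def power_prod_laurent
    by (simp add: fls_times_fps_to_fls fls_shifted_times_simps)
qed (simp add: power_prod_partial_def)

text \<open>In the variable \<open>X\<close> this is
  \<open>X^(1+e) (X^(-e) a)' = X a' - e a\<close>: conjugation by the singular factor turns
  differentiation into an Euler operator without poles.\<close>

lemma fls_deriv_laurent:
  fixes a :: "complex fps"
  shows "fls_shift (- 1 - e) (fls_deriv (fls_shift e (fps_to_fls a)))
           = fps_to_fls (fps_X * fps_deriv a - fps_const (of_int e) * a)"
proof (rule fls_eqI)
  fix m
  have idx: "m + (- 1 - e) + 1 = m - e" "m - e + e = m" by simp_all
  have nth: "fls_nth (fls_shift (- 1 - e) (fls_deriv (fls_shift e (fps_to_fls a)))) m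
      = of_int (m - e) * fls_nth (fps_to_fls a) m"
    by (simp only: fls_shift_nth fls_deriv_nth idx)
  show "fls_nth (fls_shift (- 1 - e) (fls_deriv (fls_shift e (fps_to_fls a)))) m
    = fls_nth (fps_to_fls (fps_X * fps_deriv a - fps_const (of_int e) * a)) m"
  proof (cases "m < 0")
    case False
    then obtain n where n: "m = int n"
      using zero_le_imp_eq_int [of m] by auto
    have at_n: "fls_nth (fps_to_fls f) (int n) = fps_nth f n" for f :: "complex fps" by simp
    have "of_int (int n - e) * fps_nth a n = fps_nth (fps_X * fps_deriv a - fps_const (of_int e) * a) n"
      by (cases n) (simp_all add: algebra_simps)
    thus ?thesis unfolding nth unfolding n at_n .
  next
    case True
    thus ?thesis unfolding nth by simp
  qed
qed

text \<open>
  The columns \<open>y\<^sub>q = (t - t\<^sub>0)\<^bsup>\<mu> p - e q\<^esup> g q p\<close> solve the linearised system; as the leading matrix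
  \<open>g q p\<close> at \<open>0\<close> is nonsingular, the coefficient matrix of that system has at most the pole
  prescribed by the weights \<open>e\<close>.
\<close>

theorem laurent_solution_converges:
  fixes a :: "'q \<Rightarrow> complex fps" and e :: "'q \<Rightarrow> int" and g :: "'q \<Rightarrow> 'p \<Rightarrow> complex fps"
  defines "u \<equiv> \<lambda>q. fls_shift (e q) (fps_to_fls (a q))"
  assumes "finite Q" "finite M"
    and c: "\<And>i \<alpha>. i \<in> Q \<Longrightarrow> \<alpha> \<in> M \<Longrightarrow> fps_conv_radius (c i \<alpha>) > 0"
    and eq: "\<And>i. i \<in> Q \<Longrightarrow> fls_deriv (u i) = (\<Sum>\<alpha>\<in>M. fps_to_fls (c i \<alpha>) * power_prod Q u \<alpha>)"
    and var: "\<And>i p. i \<in> Q \<Longrightarrow> p \<in> I \<Longrightarrow> fls_deriv (fls_shift (e i - \<mu> p) (fps_to_fls (g i p)))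
        = (\<Sum>q\<in>Q. (\<Sum>\<alpha>\<in>M. fps_to_fls (c i \<alpha>) * power_prod_partial Q u \<alpha> q)
                     * fls_shift (e q - \<mu> p) (fps_to_fls (g q p)))"
    and nonsing: "\<And>c. (\<And>p. p \<in> I \<Longrightarrow> (\<Sum>q\<in>Q. c q * fps_nth (g q p) 0) = 0) \<Longrightarrow> (\<And>q. q \<in> Q \<Longrightarrow> c q = 0)"
    and "q \<in> Q"
  shows "fps_conv_radius (a q) > 0"
proof -
  define A where "A = (\<lambda>i q. \<Sum>\<alpha>\<in>M. fps_to_fls (c i \<alpha>) * power_prod_partial Q u \<alpha> q)"
  define L where "L = (\<lambda>i q. fls_shift (e q - 1 - e i) (A i q))"
  define d where "d = (\<lambda>\<alpha>. \<Sum>q\<in>Q. int (\<alpha> q) * e q)"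
  have d_eq: "(\<Sum>q\<in>Q. int (\<alpha> q) * e q) = d \<alpha>" for \<alpha> by (simp add: d_def)
  have L_regular: "fls_nth (L i q) k = 0" if "i \<in> Q" "q \<in> Q" "k < 0" for i q k
  proof (rule fls_regular_if_leading_matrix_nonsingular [where Q = Q and I = I and g = g])
    fix p k assume p: "p \<in> I" and k: "k < (0::int)"
    have "(\<Sum>q\<in>Q. L i q * fps_to_fls (g q p))
        = fls_shift (\<mu> p - 1 - e i) (\<Sum>q\<in>Q. A i q * fls_shift (e q - \<mu> p) (fps_to_fls (g q p)))"
      unfolding L_def fls_shift_sum
      by (intro sum.cong) (auto simp: fls_shifted_times_simps algebra_simps)
    \<comment> \<open>This is \<open>X^(1 + e i - \<mu> p)\<close> times the derivative of
      \<open>X^(\<mu> p - e i) * g i p\<close>, an Euler operator applied to a power series, hence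
      free of poles.\<close>
    also have "\<dots> = fls_shift (\<mu> p - 1 - e i) (fls_deriv (fls_shift (e i - \<mu> p) (fps_to_fls (g i p))))"
      using var [OF \<open>i \<in> Q\<close> p] by (simp add: A_def)
    finally show "fls_nth (\<Sum>q\<in>Q. L i q * fps_to_fls (g q p)) k = 0"
      using k by simp
  next
    fix c :: "'q \<Rightarrow> complex" and q
    assume "\<And>p. p \<in> I \<Longrightarrow> (\<Sum>q\<in>Q. c q * fps_nth (g q p) 0) = 0" "q \<in> Q"
    thus "c q = 0" by (rule nonsing)
  qed (use that \<open>finite Q\<close> in auto)

  \<comment> \<open>In equation \<open>i\<close> the monomial \<open>\<alpha>\<close> carries the
    factor \<open>X^(1 + e i - d \<alpha>)\<close>, possibly a pole; \<open>P\<close> clears the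
    finitely many poles at once.\<close>
  obtain P :: nat where P: "\<And>i \<alpha>. i \<in> Q \<Longrightarrow> \<alpha> \<in> M \<Longrightarrow> 0 \<le> int P + 1 + e i - d \<alpha>"
  proof
    define P where "P = (\<Sum>i\<in>Q. nat \<bar>e i\<bar>) + (\<Sum>\<alpha>\<in>M. nat \<bar>d \<alpha>\<bar>)"
    fix i \<alpha> assume "i \<in> Q" "\<alpha> \<in> M"
    hence "nat \<bar>e i\<bar> \<le> (\<Sum>i\<in>Q. nat \<bar>e i\<bar>)" "nat \<bar>d \<alpha>\<bar> \<le> (\<Sum>\<alpha>\<in>M. nat \<bar>d \<alpha>\<bar>)"
      using assms by (auto intro!: member_le_sum)
    thus "0 \<le> int P + 1 + e i - d \<alpha>"
      unfolding P_def by linarith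
  qed
  define G where "G = (\<lambda>i \<alpha>. fps_X ^ nat (int P + 1 + e i - d \<alpha>) * c i \<alpha>)"
  have G: "fps_to_fls (G i \<alpha>) = fls_shift (d \<alpha> - e i - 1 - int P) (fps_to_fls (c i \<alpha>))"
    if "i \<in> Q" "\<alpha> \<in> M" for i \<alpha>
    unfolding G_def fps_to_fls_X_power_mult using P [OF that] by (simp add: algebra_simps)

  show ?thesis
  proof (rule formal_solution_converges [where Q = Q and M = M and P = P and G = G and a = a
        and \<kappa> = "\<lambda>i. of_int (e i)"])
    show "fps_conv_radius (G i \<alpha>) > 0" if "i \<in> Q" "\<alpha> \<in> M" for i \<alpha>
      unfolding G_def by (intro fps_conv_radius_pos_mult c that) simp
  next
    fix i assume i: "i \<in> Q"
    have "fps_to_fls (\<Sum>\<alpha>\<in>M. G i \<alpha> * power_prod Q a \<alpha>)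
        = (\<Sum>\<alpha>\<in>M. fls_shift (- 1 - e i + - int P) (fps_to_fls (c i \<alpha>) * power_prod Q u \<alpha>))"
      unfolding fps_to_fls_sum fls_times_fps_to_fls u_def power_prod_laurent d_eq
      by (intro sum.cong) (auto simp: G i fls_shifted_times_simps algebra_simps)
    also have "\<dots> = fls_shift (- int P) (fls_shift (- 1 - e i) (fls_deriv (u i)))"
      unfolding eq [OF i] fls_shift_sum fls_shift_fls_shift ..
    also have "\<dots> = fps_to_fls (fps_X ^ P * (fps_X * fps_deriv (a i) - fps_const (of_int (e i)) * a i))"
      unfolding u_def fls_deriv_laurent fps_to_fls_X_power_mult ..
    finally show "fps_X ^ P * (fps_X * fps_deriv (a i) - fps_const (of_int (e i)) * a i)
        = (\<Sum>\<alpha>\<in>M. G i \<alpha> * power_prod Q a \<alpha>)"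
      by simp
  next
    fix i q assume iq: "i \<in> Q" "q \<in> Q"
    have L: "L i q = fps_to_fls (fls_regpart (L i q))"
      using L_regular [OF iq] by (intro fls_eqI) (auto simp: not_less)
    have "fps_to_fls (\<Sum>\<alpha>\<in>M. G i \<alpha> * power_prod_partial Q a \<alpha> q)
        = (\<Sum>\<alpha>\<in>M. fls_shift (e q - 1 - e i + - int P) (fps_to_fls (c i \<alpha>) * power_prod_partial Q u \<alpha> q))"
      unfolding fps_to_fls_sum fls_times_fps_to_fls u_def power_prod_partial_laurent [OF \<open>finite Q\<close> iq(2)]
        d_eq
      by (intro sum.cong) (auto simp: G iq fls_shifted_times_simps algebra_simps)
    also have "\<dots> = fls_shift (- int P) (L i q)"
      unfolding L_def A_def fls_shift_sum fls_shift_fls_shift ..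
    also have "\<dots> = fps_to_fls (fps_X ^ P * fls_regpart (L i q))"
      by (subst L) (simp only: fps_to_fls_X_power_mult)
    finally show "fps_X ^ P dvd (\<Sum>\<alpha>\<in>M. G i \<alpha> * power_prod_partial Q a \<alpha> q)"
      by simp
  qed (use assms in auto)
qed

section \<open>Balances\<close>

text \<open>On the line through \<open>x\<close> in direction \<open>p\<close>, every monomial with
  a positive exponent in another variable vanishes. What survives is a power series in one variable,
  hence holomorphic.\<close>

lemma mv_analytic_on_has_partial_deriv:
  assumes "mv_analytic_on m g D" "x \<in> D" "x \<in> cspace m" "p \<in> {1..m}"
  shows "((\<lambda>z. g (x(p := z))) has_field_derivative partial_deriv p g x) (at (x p))"
proof -
  from assms(1,2) obtain c \<rho> where "\<rho> > 0" and c: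
    "\<And>z. z \<in> cspace m \<Longrightarrow> (\<And>q. q \<in> {1..m} \<Longrightarrow> dist (z q) (x q) < \<rho>) \<Longrightarrow>
       ((\<lambda>\<alpha>. c \<alpha> * (\<Prod>q=1..m. (z q - x q) ^ \<alpha> q)) has_sum g z) (multi_indices m)"
    unfolding mv_analytic_on_def by blast
  \<comment> \<open>Multi-indices concentrated at \<open>p\<close>; the restriction supplies the
    extensional value that \<open>multi_indices\<close> requires outside
    \<open>{1..m}\<close>.\<close>
  define \<iota> :: "nat \<Rightarrow> nat \<Rightarrow> nat" where "\<iota> = (\<lambda>k. \<lambda>q\<in>{1..m}. if q = p then k else 0)"
  have inj: "inj \<iota>"
    using assms(4) by (intro injI) (auto simp: \<iota>_def dest!: fun_cong [where x = p])
  have "(\<lambda>k. c (\<iota> k) * (z - x p) ^ k) sums g (x(p := z))" if z: "z \<in> ball (x p) \<rho>" for z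
  proof -
    let ?y = "x(p := z)"
    let ?t = "\<lambda>\<alpha>. c \<alpha> * (\<Prod>q=1..m. (?y q - x q) ^ \<alpha> q)"
    have "?y \<in> cspace m"
      using assms(3,4) by (auto simp: cspace_def PiE_def extensional_def)
    moreover have "dist (?y q) (x q) < \<rho>" for q
      using z \<open>\<rho> > 0\<close> by (simp add: dist_commute)
    ultimately have "(?t has_sum g ?y) (multi_indices m)" by (rule c)
    also have "(?t has_sum g ?y) (multi_indices m) \<longleftrightarrow> (?t has_sum g ?y) (range \<iota>)"
    proof (rule has_sum_cong_neutral)
      fix \<alpha> assume \<alpha>: "\<alpha> \<in> multi_indices m - range \<iota>"
      have "\<exists>q\<in>{1..m} - {p}. \<alpha> q \<noteq> 0"
      proof (rule ccontr)
        assume "\<not> ?thesis"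
        hence "\<alpha> = \<iota> (\<alpha> p)"
          using \<alpha> assms(4) by (auto simp: \<iota>_def multi_indices_def PiE_def extensional_def fun_eq_iff)
        thus False using \<alpha> by auto
      qed
      then obtain q where "q \<in> {1..m}" "q \<noteq> p" "\<alpha> q \<noteq> 0" by blast
      hence "(\<Prod>q=1..m. (?y q - x q) ^ \<alpha> q) = 0"
        by (intro prod_zero bexI [of _ q]) auto
      thus "?t \<alpha> = 0" by simp
    qed (auto simp: \<iota>_def multi_indices_def)
    also have "\<dots> \<longleftrightarrow> ((?t \<circ> \<iota>) has_sum g ?y) UNIV"
      using inj by (rule has_sum_reindex)
    also have "?t \<circ> \<iota> = (\<lambda>k. c (\<iota> k) * (z - x p) ^ k)"
    proof
      fix k
      have "(\<Prod>q=1..m. (?y q - x q) ^ \<iota> k q) = (\<Prod>q\<in>{p}. (?y q - x q) ^ \<iota> k q)"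
        using assms(4) by (intro prod.mono_neutral_right) (auto simp: \<iota>_def)
      thus "(?t \<circ> \<iota>) k = c (\<iota> k) * (z - x p) ^ k"
        using assms(4) by (simp add: \<iota>_def)
    qed
    finally show ?thesis by (rule has_sum_imp_sums)
  qed
  hence "(\<lambda>z. g (x(p := z))) holomorphic_on ball (x p) \<rho>"
    by (rule power_series_holomorphic)
  hence "((\<lambda>z. g (x(p := z))) has_field_derivative deriv (\<lambda>z. g (x(p := z))) (x p)) (at (x p))"
    using \<open>\<rho> > 0\<close> by (intro holomorphic_derivI [of _ "ball (x p) \<rho>"]) auto
  thus ?thesis by (simp add: partial_deriv_def)
qed

lemma open_cspace_subset: "open_cspace m D \<Longrightarrow> D \<subseteq> cspace m"
  unfolding open_cspace_def cspace_def
  by (drule openin_subset) (simp add: topspace_product_topology)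

lemma open_cspace_eventually_update:
  assumes "open_cspace m D" "x \<in> D" "p \<in> {1..m}"
  shows "\<forall>\<^sub>F z in nhds (x p). x(p := z) \<in> D"
proof -
  from bspec [OF assms(1) [unfolded open_cspace_def openin_product_topology_alt] assms(2)]
  obtain U where "\<forall>i\<in>{1..m}. openin euclidean (U i)" and U: "x \<in> Pi\<^sub>E {1..m} U" "Pi\<^sub>E {1..m} U \<subseteq> D"
    by (elim exE conjE)
  hence U_open: "open (U i)" if "i \<in> {1..m}" for i
    using that by simp
  have "x(p := z) \<in> D" if "z \<in> U p" for z
  proof -
    have "x(p := z) \<in> Pi\<^sub>E {1..m} U"
      using U(1) that assms(3) by (auto simp: PiE_def extensional_def)
    thus ?thesis using U(2) by blast
  qed
  moreover have "open (U p)" "x p \<in> U p" using U(1) U_open assms(3) by auto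
  ultimately show ?thesis unfolding eventually_nhds by blast
qed

text \<open>If \<open>c A = 0\<close> then \<open>c = c A B = 0\<close>. The left kernel matters
  because the rows of the linearised system multiply the resonance matrix from the left.\<close>

lemma invertible_mat_left_kernel:
  fixes F :: "nat \<times> nat \<Rightarrow> 'a::comm_ring_1"
  assumes "invertible_mat (mat n n F)"
    and zero: "\<And>j. j < n \<Longrightarrow> (\<Sum>i<n. c i * F (i, j)) = 0" and "i < n"
  shows "c i = 0"
proof -
  define A where "A = mat n n F"
  from assms(1) obtain B where B: "A * B = 1\<^sub>m (dim_row A)" "B * A = 1\<^sub>m (dim_row B)"
    unfolding invertible_mat_def inverts_mat_def A_def by blast
  have dim_A: "dim_row A = n" "dim_col A = n" by (simp_all add: A_def)
  \<comment> \<open>\<open>invertible_mat\<close> does not fix the size of \<open>B\<close>; it is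
    read off from the two identity matrices.\<close>
  have "dim_col (A * B) = n" "dim_col (B * A) = dim_row B"
    unfolding B by (simp_all add: dim_A)
  hence dim_B: "dim_row B = n" "dim_col B = n" by (simp_all add: dim_A)
  have id: "(\<Sum>j<n. F (k, j) * index_mat B (j, i)) = (if k = i then 1 else 0)" if "k < n" for k
  proof -
    have "index_mat (A * B) (k, i) = (\<Sum>j<n. F (k, j) * index_mat B (j, i))"
      using that \<open>i < n\<close> dim_A dim_B
      by (simp add: scalar_prod_def atLeast0LessThan) (simp add: A_def)
    thus ?thesis using that \<open>i < n\<close> unfolding B by (simp add: dim_A)
  qed
  have "c i = (\<Sum>k<n. c k * (if k = i then 1 else 0))"
    using \<open>i < n\<close> by (simp add: if_distrib cong: if_cong)
  also have "\<dots> = (\<Sum>k<n. c k * (\<Sum>j<n. F (k, j) * index_mat B (j, i)))"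
    by (intro sum.cong) (auto simp: id)
  also have "\<dots> = (\<Sum>j<n. (\<Sum>k<n. c k * F (k, j)) * index_mat B (j, i))"
    unfolding sum_distrib_left sum_distrib_right by (subst sum.swap) (simp add: mult_ac)
  also have "\<dots> = 0" by (simp add: zero)
  finally show ?thesis .
qed

text \<open>As \<open>num_par\<close> increases strictly from 1, the half-open intervals between its
  consecutive values partition the indices from 2 to \<open>total_par B\<close>, so the definite
  description in \<open>res_block\<close> denotes.\<close>

lemma is_balance_res_block:
  assumes "is_balance n \<Omega> f B" "2 \<le> p" "p \<le> total_par B"
  shows "res_block B p \<in> {1..num_res B}" "num_par B (res_block B p - 1) < p" "p \<le> num_par B (res_block B p)"
proof -
  have N0: "num_par B 0 = 1" and mono: "strict_mono_on {0..num_res B} (num_par B)"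
    using assms(1) unfolding is_balance_def by auto
  define l where "l = (LEAST l. p \<le> num_par B l)"
  have l: "p \<le> num_par B l" unfolding l_def using assms(3) by (rule LeastI)
  have "l \<le> num_res B" unfolding l_def using assms(3) by (rule Least_le)
  moreover have "l \<noteq> 0" using l N0 assms(2) by (cases l) auto
  moreover have "num_par B (l - 1) < p"
    using not_less_Least [of "l - 1" "\<lambda>l. p \<le> num_par B l"] \<open>l \<noteq> 0\<close> by (auto simp: l_def [symmetric])
  ultimately have l_prop: "l \<in> {1..num_res B} \<and> num_par B (l - 1) < p \<and> p \<le> num_par B l"
    using l by auto
  have mono': "num_par B k \<le> num_par B k'" if "k \<le> k'" "k' \<le> num_res B" for k k'
    using strict_mono_onD [OF mono, of k k'] that by (cases "k = k'") auto
  have "k = l" if k: "k \<in> {1..num_res B} \<and> num_par B (k - 1) < p \<and> p \<le> num_par B k" for k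
  proof (rule ccontr)
    assume "k \<noteq> l"
    then consider "k \<le> l - 1" | "l \<le> k - 1" using k l_prop by force
    thus False
    proof cases
      case 1
      hence "num_par B k \<le> num_par B (l - 1)" using l_prop by (intro mono') auto
      thus False using k l_prop by linarith
    next
      case 2
      hence "num_par B l \<le> num_par B (k - 1)" using k by (intro mono') auto
      thus False using k l_prop by linarith
    qed
  qed
  with l_prop have "\<exists>!l. l \<in> {1..num_res B} \<and> num_par B (l - 1) < p \<and> p \<le> num_par B l" by blast
  from theI' [OF this] show "res_block B p \<in> {1..num_res B}" "num_par B (res_block B p - 1) < p"
    "p \<le> num_par B (res_block B p)"
    unfolding res_block_def by auto
qed

text \<open>The dependence clause that applies to \<open>j\<close> admits only parameters introduced
  before the block of \<open>p\<close>.\<close>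

lemma is_balance_coef_update:
  assumes bal: "is_balance n \<Omega> f B" and p: "2 \<le> p" "p \<le> total_par B" and "i \<in> {1..n}"
    and j: "j < resonance B (res_block B p)" and "x \<in> par_dom B" "x(p := z) \<in> par_dom B"
  shows "coef B i j (x(p := z)) = coef B i j x"
proof -
  have mono: "strict_mono_on {0..num_res B} (num_par B)"
    and dep: "\<And>l. l \<in> {0..num_res B} \<Longrightarrow>
        (1 \<le> l \<longrightarrow> resonance B l \<le> j) \<and> (l < num_res B \<longrightarrow> j < resonance B (Suc l)) \<Longrightarrow>
        depends_only_on (num_par B l) (coef B i j) (par_dom B)"
    using bal \<open>i \<in> {1..n}\<close> unfolding is_balance_def by auto
  let ?l = "res_block B p"
  note block = is_balance_res_block [OF bal p]
  \<comment> \<open>\<open>k\<close> counts the resonances not exceeding \<open>j\<close>, which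
    selects the dependence clause for \<open>j\<close>; for \<open>k = 0\<close> only t_0 is
    left.\<close>
  define k where "k = (LEAST k. j < resonance B (Suc k))"
  have "j < resonance B (Suc (?l - 1))" using j block(1) by simp
  hence k: "j < resonance B (Suc k)" "k \<le> ?l - 1"
    unfolding k_def by (auto intro: LeastI Least_le)
  have "resonance B k \<le> j" if "1 \<le> k"
    using not_less_Least [of "k - 1" "\<lambda>k. j < resonance B (Suc k)"] that by (auto simp: k_def [symmetric])
  with k block(1) have dep_k: "depends_only_on (num_par B k) (coef B i j) (par_dom B)"
    by (intro dep) auto
  have "num_par B k < p"
  proof (cases "k = ?l - 1")
    case False
    hence "num_par B k < num_par B (?l - 1)"
      using k(2) block(1) by (intro strict_mono_onD [OF mono]) auto
    thus ?thesis using block(2) by linarith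
  qed (use block in auto)
  hence "\<forall>q\<in>{1..num_par B k}. (x(p := z)) q = x q" by auto
  thus ?thesis
    using dep_k assms(6,7) unfolding depends_only_on_def by blast
qed

theorem mainTheorem3:
  fixes n :: nat and \<Omega> :: "complex set"
    and f :: "nat \<Rightarrow> complex \<Rightarrow> (nat \<Rightarrow> complex) \<Rightarrow> complex"
  assumes "regular_system n \<Omega> f"
    and "passes_painleve_test n \<Omega> f"
  shows "\<forall>B. principal_balance n \<Omega> f B \<longrightarrow> balance_converges n B"
proof (intro allI impI)
  fix B assume princ: "principal_balance n \<Omega> f B"
  have bal: "is_balance n \<Omega> f B" and tot: "total_par B = n"
    using princ unfolding principal_balance_def by auto
  have open_dom: "open_cspace n (par_dom B)" and x1: "\<And>x. x \<in> par_dom B \<Longrightarrow> x 1 \<in> \<Omega>"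
    and an: "\<And>i j. i \<in> {1..n} \<Longrightarrow> mv_analytic_on n (coef B i j) (par_dom B)"
    using bal tot unfolding is_balance_def by auto
  have "formally_solves n \<Omega> f B"
    using bal unfolding is_balance_def by blast
  then obtain M c where form: "polynomial_form n \<Omega> f M c"
    and eq: "\<And>x i. x \<in> par_dom B \<Longrightarrow> i \<in> {1..n} \<Longrightarrow> fls_deriv (laurent_sol B i x) =
       (\<Sum>\<alpha>\<in>M. fps_to_fls (fps_expansion (c i \<alpha>) (x 1)) * power_prod {1..n} (\<lambda>q. laurent_sol B q x) \<alpha>)"
    unfolding formally_solves_def power_prod_def by blast
  have "finite M" and c_an: "\<And>i \<alpha>. i \<in> {1..n} \<Longrightarrow> \<alpha> \<in> M \<Longrightarrow> c i \<alpha> analytic_on \<Omega>"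
    using form unfolding polynomial_form_def by auto

  have conv: "fps_conv_radius (Abs_fps (\<lambda>j. coef B q j x)) > 0"
    if x: "x \<in> par_dom B" and q: "q \<in> {1..n}" for x q
  proof -
    define e where "e = expo B"
    define a where "a = (\<lambda>q. Abs_fps (\<lambda>j. coef B q j x))"
    define u where "u = (\<lambda>q. fls_shift (e q) (fps_to_fls (a q)))"
    define v where "v = (\<lambda>p q. Abs_fps (\<lambda>j. partial_deriv p (coef B q j) x))"
    define V where "V = (\<lambda>p q. fls_shift (e q) (fps_to_fls (v p q)))"
    define A where "A = (\<lambda>i q. \<Sum>\<alpha>\<in>M. fps_to_fls (fps_expansion (c i \<alpha>) (x 1)) * power_prod_partial {1..n} u \<alpha> q)"
    \<comment> \<open>Exponents of the columns: a resonance for each \<open>r_p\<close>, and -1 for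
      t_0, because differentiating in t_0 can raise the pole order by one.\<close>
    define \<mu> where "\<mu> = (\<lambda>p. if p = 1 then - 1 else int (resonance B (res_block B p)))"
    \<comment> \<open>For \<open>p = 1\<close> this is \<open>u' - V 1\<close>, the negative of the
      total t_0-derivative at fixed t, scaled by \<open>X^(1 + e q)\<close>. The series
      \<open>V 1\<close> alone ignores that the expansion variable moves with t_0.\<close>
    define g where "g = (\<lambda>q p. if p = 1 then fps_X * fps_deriv (a q) - fps_const (of_int (e q)) * a q - fps_X * v 1 q
                               else fps_shift (resonance B (res_block B p)) (v p q))"
    have u_eq: "fls_shift (e q) (fps_to_fls (a q)) = u q" for q by (simp add: u_def)
    have x_cspace: "x \<in> cspace n" using open_cspace_subset [OF open_dom] x by blast
    have sol: "laurent_sol B q x = u q" for q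
      by (simp add: laurent_sol_def u_def a_def e_def)
    have c_x1: "c i \<alpha> analytic_on {x 1}" if "i \<in> {1..n}" "\<alpha> \<in> M" for i \<alpha>
      using c_an [OF that] x1 [OF x] by (auto intro: analytic_on_subset)
    have partial: "((\<lambda>z. coef B q j (x(p := z))) has_field_derivative partial_deriv p (coef B q j) x) (at (x p))"
      if "q \<in> {1..n}" "p \<in> {1..n}" for p q j
      by (rule mv_analytic_on_has_partial_deriv [OF an x x_cspace]) fact+
    have near: "\<forall>\<^sub>F z in nhds (x p). x(p := z) \<in> par_dom B" if "p \<in> {1..n}" for p
      by (rule open_cspace_eventually_update [OF open_dom x that])
    have U: "fls_param_deriv (\<lambda>z. laurent_sol B q (x(p := z))) (V p q) (x p)"
      if "q \<in> {1..n}" "p \<in> {1..n}" for p q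
      unfolding laurent_sol_def V_def v_def e_def
      by (rule fls_param_deriv_laurent) (rule partial [OF that])
    \<comment> \<open>\<open>C'\<close> differentiates the expanded coefficients in the parameter.
      It is taken to be 0 for \<open>p \<noteq> 1\<close>, as only t_0 moves the centre of
      expansion.\<close>
    have variation: "fls_deriv (V p i) = (\<Sum>\<alpha>\<in>M. C' \<alpha> * power_prod {1..n} u \<alpha>) + (\<Sum>q\<in>{1..n}. A i q * V p q)"
      if p: "p \<in> {1..n}" and i: "i \<in> {1..n}"
        and C: "\<And>\<alpha>. \<alpha> \<in> M \<Longrightarrow> fls_param_deriv
          (\<lambda>z. fps_to_fls (fps_expansion (c i \<alpha>) ((x(p := z)) 1))) (C' \<alpha>) (x p)" for p i C'
    proof -
      have "\<forall>\<^sub>F z in nhds (x p). fls_deriv (laurent_sol B i (x(p := z))) =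
         (\<Sum>\<alpha>\<in>M. fps_to_fls (fps_expansion (c i \<alpha>) ((x(p := z)) 1))
                 * power_prod {1..n} (\<lambda>q. laurent_sol B q (x(p := z))) \<alpha>)"
        using near [OF p] by eventually_elim (rule eq [OF _ i])
      from fls_param_deriv_unique [OF fls_param_deriv_fls_deriv [OF U [OF i p]]
          fls_param_deriv_polynomial [OF finite_atLeastAtMost \<open>finite M\<close> C U] this] p
      show ?thesis by (simp add: sol A_def)
    qed

    have weighted: "fls_shift (e q - \<mu> p) (fps_to_fls (g q p)) = (if p = 1 then fls_deriv (u q) - V 1 q else V p q)"
      if p: "p \<in> {1..n}" and q: "q \<in> {1..n}" for p q
    proof (cases "p = 1")
      case True
      have "fls_deriv (u q) = fls_shift (e q + 1) (fls_shift (- 1 - e q) (fls_deriv (u q)))"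
        by simp
      also have "\<dots> = fls_shift (e q + 1) (fps_to_fls (fps_X * fps_deriv (a q) - fps_const (of_int (e q)) * a q))"
        unfolding u_def fls_deriv_laurent ..
      finally have "fls_deriv (u q) = \<dots>" .
      moreover have "V 1 q = fls_shift (e q + 1) (fps_to_fls (fps_X ^ 1 * v 1 q))"
        unfolding V_def fps_to_fls_X_power_mult by simp
      ultimately show ?thesis using True
        by (simp add: \<mu>_def g_def)
    next
      case False
      hence p2: "2 \<le> p" "p \<le> total_par B" using p tot by auto
      let ?l = "resonance B (res_block B p)"
      have "partial_deriv p (coef B q j) x = 0" if "j < ?l" for j
      proof -
        have "\<forall>\<^sub>F z in nhds (x p). coef B q j (x(p := z)) = coef B q j x"
          using near [OF p]
          by eventually_elim (rule is_balance_coef_update [OF bal p2 q that x])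
        hence "((\<lambda>z. coef B q j x) has_field_derivative partial_deriv p (coef B q j) x) (at (x p))"
          using partial [OF q p, of j] by (simp add: DERIV_cong_ev)
        thus ?thesis by (auto intro: DERIV_unique)
      qed
      hence "v p q = fps_X ^ ?l * fps_shift ?l (v p q)"
        by (intro fps_ext) (auto simp: v_def fps_X_power_mult_nth)
      hence "V p q = fls_shift (e q) (fps_to_fls (fps_X ^ ?l * fps_shift ?l (v p q)))"
        unfolding V_def by metis
      also have "\<dots> = fls_shift (e q - \<mu> p) (fps_to_fls (g q p))"
        using False unfolding fps_to_fls_X_power_mult by (simp add: \<mu>_def g_def)
      finally show ?thesis using False by simp
    qed

    \<comment> \<open>For \<open>p = 1\<close> the terms with a factor \<open>fps_X\<close> drop out
      and \<open>-k_q a_{q,0}\<close> remains; for the others the shift has brought the coefficient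
      at the resonance to index 0.\<close>
    have lead: "fps_nth (g q p) 0 = res_entry B x q p" for p q
      by (simp add: g_def res_entry_def a_def v_def e_def)

    have "fps_conv_radius (a q) > 0"
    proof (rule laurent_solution_converges [where Q = "{1..n}" and M = M and e = e and a = a
          and c = "\<lambda>i \<alpha>. fps_expansion (c i \<alpha>) (x 1)" and I = "{1..n}" and \<mu> = \<mu> and g = g,
          unfolded u_eq])
      fix i \<alpha> assume "i \<in> {1..n}" "\<alpha> \<in> M"
      then obtain r where r: "r > 0" "c i \<alpha> holomorphic_on ball (x 1) r"
        using c_x1 unfolding analytic_on_def by blast
      hence "fps_conv_radius (fps_expansion (c i \<alpha>) (x 1)) \<ge> ereal r"
        by (intro conv_radius_fps_expansion) (simp add: eball_def ball_def)
      thus "fps_conv_radius (fps_expansion (c i \<alpha>) (x 1)) > 0"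
        using r(1) by (metis ereal_less(2) less_le_trans)
    next
      fix i assume "i \<in> {1..n}"
      thus "fls_deriv (u i) = (\<Sum>\<alpha>\<in>M. fps_to_fls (fps_expansion (c i \<alpha>) (x 1)) * power_prod {1..n} u \<alpha>)"
        using eq [OF x] by (simp add: sol)
    next
      fix i p assume i: "i \<in> {1..n}" and p: "p \<in> {1..n}"
      have "fls_deriv (fls_shift (e i - \<mu> p) (fps_to_fls (g i p)))
          = (\<Sum>q\<in>{1..n}. A i q * fls_shift (e q - \<mu> p) (fps_to_fls (g q p)))"
      proof (cases "p = 1")
        case True
        \<comment> \<open>The explicit dependence on t puts the same inhomogeneous term into the
          equations for \<open>V 1\<close> and for \<open>u'\<close>; it cancels in their
          difference, which solves the homogeneous linearised system.\<close>
        have "fls_deriv (V 1 i) = (\<Sum>\<alpha>\<in>M. fls_deriv (fps_to_fls (fps_expansion (c i \<alpha>) (x 1)))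
            * power_prod {1..n} u \<alpha>) + (\<Sum>q\<in>{1..n}. A i q * V 1 q)"
          using p True i fls_param_deriv_fps_expansion [OF c_x1 [OF i]] by (intro variation) simp_all
        moreover have "fls_deriv (fls_deriv (u i)) = (\<Sum>\<alpha>\<in>M. fls_deriv (fps_to_fls (fps_expansion (c i \<alpha>) (x 1)))
            * power_prod {1..n} u \<alpha>) + (\<Sum>q\<in>{1..n}. A i q * fls_deriv (u q))"
          using eq [OF x i] unfolding sol A_def by (simp add: fls_deriv_polynomial)
        moreover have "(\<Sum>q\<in>{1..n}. A i q * fls_shift (e q - \<mu> p) (fps_to_fls (g q p)))
            = (\<Sum>q\<in>{1..n}. A i q * (fls_deriv (u q) - V 1 q))"
          using True weighted [OF p] by (intro sum.cong refl) simp
        ultimately show ?thesis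
          using True weighted [OF p i] by (simp add: right_diff_distrib sum_subtractf)
      next
        case False
        have "fls_deriv (V p i) = (\<Sum>\<alpha>\<in>M. 0 * power_prod {1..n} u \<alpha>) + (\<Sum>q\<in>{1..n}. A i q * V p q)"
          using False by (intro variation p i fls_param_deriv_const) auto
        moreover have "(\<Sum>q\<in>{1..n}. A i q * fls_shift (e q - \<mu> p) (fps_to_fls (g q p)))
            = (\<Sum>q\<in>{1..n}. A i q * V p q)"
          using False weighted [OF p] by (intro sum.cong refl) simp
        ultimately show ?thesis
          using False weighted [OF p i] by simp
      qed
      thus "fls_deriv (fls_shift (e i - \<mu> p) (fps_to_fls (g i p))) =
         (\<Sum>q\<in>{1..n}. (\<Sum>\<alpha>\<in>M. fps_to_fls (fps_expansion (c i \<alpha>) (x 1)) * power_prod_partial {1..n} u \<alpha> q)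
                        * fls_shift (e q - \<mu> p) (fps_to_fls (g q p)))"
        by (simp only: A_def)
    next
      fix d :: "nat \<Rightarrow> complex" and q
      assume d: "\<And>p. p \<in> {1..n} \<Longrightarrow> (\<Sum>q\<in>{1..n}. d q * fps_nth (g q p) 0) = 0" and q: "q \<in> {1..n}"
      have inv: "invertible_mat (mat n n (\<lambda>(i, p). res_entry B x (Suc i) (Suc p)))"
        using princ x tot unfolding principal_balance_def resonance_matrix_def by auto
      \<comment> \<open>Matrix positions start at 0 and equations at 1, hence \<open>q\<close> is
        written as a successor.\<close>
      have "d (Suc (q - 1)) = 0"
      proof (rule invertible_mat_left_kernel [OF inv, where c = "\<lambda>i. d (Suc i)"])
        fix j assume "j < n"
        hence "(\<Sum>q\<in>{1..n}. d q * fps_nth (g q (Suc j)) 0) = 0" by (intro d) auto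
        also have "{1..n} = Suc ` {..<n}" by (simp add: image_Suc_lessThan)
        finally show "(\<Sum>i<n. d (Suc i) * (case (i, j) of (i, p) \<Rightarrow> res_entry B x (Suc i) (Suc p))) = 0"
          by (simp add: sum.reindex lead)
      qed (use q in auto)
      thus "d q = 0" using q by simp
    qed (use \<open>finite M\<close> q in auto)
    thus ?thesis by (simp add: a_def)
  qed

  show "balance_converges n B"
    unfolding balance_converges_def
  proof
    fix x assume x: "x \<in> par_dom B"
    let ?a = "\<lambda>i. Abs_fps (\<lambda>j. coef B i j x)"
    have "\<exists>r>0. ereal r < fps_conv_radius (?a i)" if "i \<in> {1..n}" for i
      using ereal_dense2 [OF conv [OF x that]] by auto
    then obtain r where r: "\<And>i. i \<in> {1..n} \<Longrightarrow> r i > 0" "\<And>i. i \<in> {1..n} \<Longrightarrow> ereal (r i) < fps_conv_radius (?a i)"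
      by metis
    define \<rho> where "\<rho> = Min (insert 1 (r ` {1..n}))"
    have "\<rho> > 0" unfolding \<rho>_def using r(1) by (subst Min_gr_iff) auto
    moreover have "summable (\<lambda>j. coef B i j x * (t - x 1) powi (int j - expo B i))"
      if t: "0 < dist t (x 1)" "dist t (x 1) < \<rho>" and i: "i \<in> {1..n}" for t i
    proof -
      have "\<rho> \<le> r i" unfolding \<rho>_def using i by (intro Min_le) auto
      hence "ereal (norm (t - x 1)) < ereal (r i)" using t by (simp add: dist_norm)
      also have "\<dots> < fps_conv_radius (?a i)" by (rule r(2) [OF i])
      finally have "summable (\<lambda>j. coef B i j x * (t - x 1) ^ j)"
        unfolding fps_conv_radius_def by (intro summable_in_conv_radius) simp
      hence "summable (\<lambda>j. coef B i j x * (t - x 1) ^ j * (t - x 1) powi (- expo B i))"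
        by (rule summable_mult2)
      moreover have "(t - x 1) powi (int j - expo B i) = (t - x 1) ^ j * (t - x 1) powi (- expo B i)" for j
        using t(1) power_int_add [of "t - x 1" "int j" "- expo B i"] by simp
      ultimately show ?thesis by (simp add: mult.assoc)
    qed
    ultimately show "\<exists>\<rho>>0. \<forall>t. 0 < dist t (x 1) \<and> dist t (x 1) < \<rho> \<longrightarrow>
        (\<forall>i\<in>{1..n}. summable (\<lambda>j. coef B i j x * (t - x 1) powi (int j - expo B i)))"
      by blast
  qed
qed

end
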